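(* Let $\{X_{1,j}: j\ge 1\}$ and $\{X_{2,j}: j\ge 1\}$ be sequences of real random variables on a common probability space such that, for $i=1,2$, the sequence $\{X_{i,j}: j\ge 1\}$ is iid with mean $\mu_i$ and finite variance $\sigma_i^2>0$. Assume that $\{(X_{1,j},X_{2,j}): j\ge 1\}$ is an independent sequence of random vectors in $\mathbb{R}^2$ (not necessarily identically distributed). Then the following four statements are equivalent: (a) $\overline{\rho}_{n_1,n_2}\to 0$ as $n_1,n_2\to\infty$, where $\overline{\rho}_{n_1,n_2}=\frac{1}{\sqrt{n_1n_2}}\sum_{j=1}^{\min(n_1,n_2)}\rho_{jj}$; (b) $\frac1k\sum_{j=1}^k\rho_{jj}\to 0$ as $k\to\infty$; (c) $\left(Y^{(1)}_{n_1},Y^{(2)}_{n_2}\right)$ converges in distribution to $\Phi\times\Phi$ as $n_1,n_2\to\infty$; (d) $\widehat{W}_{n_1,n_2}$ converges in distribution to $\Phi$ as $n_1,n_2\to\infty$, where $$\widehat{W}_{n_1,n_2}=\frac{(\overline{X}_{1,n_1}-\mu_1)-(\overline{X}_{2,n_2}-\mu_2)}{\sqrt{\frac{\sigma_1^2}{n_1}+\frac{\sigma_2^2}{n_2}}}.$$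
   Context: $\rho_{jk}$ denotes the correlation coefficient between $X_{1,j}$ and $X_{2,k}$. For $i=1,2$ and $n\ge1$, $\overline{X}_{i,n}=\frac1n\sum_{j=1}^n X_{i,j}$ and $Y^{(i)}_{n}=\sqrt{n}\,(\overline{X}_{i,n}-\mu_i)/\sigma_i$. $\Phi$ denotes the standard Normal distribution on $\mathbb{R}$ and $\Phi\times\Phi$ the product measure on $\mathbb{R}^2$ (the bivariate standard Normal distribution). Limits "as $n_1,n_2\to\infty$" are limits of double sequences, i.e. of nets indexed by $\mathbb{N}\times\mathbb{N}$ ($\mathbb{N}=\{1,2,\dots\}$) with the order $(n_1,n_2)\succeq(m_1,m_2)$ iff $n_1\ge m_1$ and $n_2\ge m_2$; no relation between $n_1$ and $n_2$ is imposed. Convergence in distribution means weak convergence of the induced probability measures (convergence of expectations of every bounded continuous real function). *)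

theory Defs
  imports "HOL-Probability.Probability"
begin

definition (in prob_space) iid_seq :: "(nat \<Rightarrow> 'a \<Rightarrow> real) \<Rightarrow> bool" where
  "iid_seq X \<longleftrightarrow> indep_vars (\<lambda>_. borel) X {1..} \<and>
     (\<forall>i\<ge>1. \<forall>j\<ge>1. distr M borel (X i) = distr M borel (X j))"

definition (in prob_space) covariance :: "('a \<Rightarrow> real) \<Rightarrow> ('a \<Rightarrow> real) \<Rightarrow> real" where
  "covariance U V = expectation (\<lambda>\<omega>. (U \<omega> - expectation U) * (V \<omega> - expectation V))"

definition (in prob_space) correlation :: "('a \<Rightarrow> real) \<Rightarrow> ('a \<Rightarrow> real) \<Rightarrow> real" where
  "correlation U V = covariance U V / (sqrt (variance U) * sqrt (variance V))"

text \<open>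
  The filter of double sequences: it is generated by the sets
  of pairs with first component at least \<open>m1\<close> and second component at least \<open>m2\<close>,
  for natural numbers \<open>m1\<close> and \<open>m2\<close>, so it is the section filter of the componentwise
  order. Whether the indices start from 0 or from 1 makes no difference.
\<close>

abbreviation double_seq :: "(nat \<times> nat) filter" where
  "double_seq \<equiv> sequentially \<times>\<^sub>F sequentially"

text \<open>
  Weak convergence along an arbitrary filter and on an arbitrary topological space;
  the constant \<open>weak_conv_m\<close> of the library covers only ordinary sequences of measures on the
  real line. It is meant for probability measures on the Borel sets.
\<close>

definition weak_conv_filter ::
    "('i \<Rightarrow> 'b::topological_space measure) \<Rightarrow> 'b measure \<Rightarrow> 'i filter \<Rightarrow> bool" where
  "weak_conv_filter \<mu> \<nu> F \<longleftrightarrow>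
     (\<forall>f :: 'b \<Rightarrow> real. continuous_on UNIV f \<longrightarrow> bounded (range f) \<longrightarrow>
        ((\<lambda>i. integral\<^sup>L (\<mu> i) f) \<longlongrightarrow> integral\<^sup>L \<nu> f) F)"

definition sample_mean :: "(nat \<Rightarrow> 'a \<Rightarrow> real) \<Rightarrow> nat \<Rightarrow> 'a \<Rightarrow> real" where
  "sample_mean X n \<omega> = (\<Sum>j=1..n. X j \<omega>) / real n"

definition standardized_mean ::
    "(nat \<Rightarrow> 'a \<Rightarrow> real) \<Rightarrow> real \<Rightarrow> real \<Rightarrow> nat \<Rightarrow> 'a \<Rightarrow> real" where
  "standardized_mean X m s n \<omega> = sqrt (real n) * (sample_mean X n \<omega> - m) / s"

definition standardized_mean_diff ::
    "(nat \<Rightarrow> 'a \<Rightarrow> real) \<Rightarrow> (nat \<Rightarrow> 'a \<Rightarrow> real) \<Rightarrow> real \<Rightarrow> real \<Rightarrow> real \<Rightarrow> real \<Rightarrow>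
     nat \<Rightarrow> nat \<Rightarrow> 'a \<Rightarrow> real" where
  "standardized_mean_diff X1 X2 m1 m2 s1 s2 n1 n2 \<omega> =
     ((sample_mean X1 n1 \<omega> - m1) - (sample_mean X2 n2 \<omega> - m2)) /
     sqrt (s1\<^sup>2 / real n1 + s2\<^sup>2 / real n2)"

definition (in prob_space) avg_correlation ::
    "(nat \<Rightarrow> 'a \<Rightarrow> real) \<Rightarrow> (nat \<Rightarrow> 'a \<Rightarrow> real) \<Rightarrow> nat \<Rightarrow> nat \<Rightarrow> real" where
  "avg_correlation X1 X2 n1 n2 =
     1 / sqrt (real n1 * real n2) * (\<Sum>j=1..min n1 n2. correlation (X1 j) (X2 j))"

end

theory Submission
  imports Defs
begin

text \<open>
  Write \<open>U j = (X1 j - \<mu>1) / \<sigma>1\<close>, \<open>V j = (X2 j - \<mu>2) / \<sigma>2\<close>, and let \<open>Y1 n\<close>, \<open>Y2 m\<close> be the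
  standardized means, that is, the sums of the first \<open>n\<close> of the \<open>U j\<close> and of the first \<open>m\<close> of the
  \<open>V j\<close> divided by \<open>sqrt n\<close> and \<open>sqrt m\<close>. Since the pairs \<open>(U j, V j)\<close> are independent,
  \<open>s * Y1 n + t * Y2 m\<close> is a sum of independent centred summands, and its variance is
  \<open>s\<^sup>2 + t\<^sup>2 + 2 s t \<rho>(n, m)\<close>, where \<open>\<rho>(n, m)\<close> is the averaged correlation of statement (a).
  Everything follows from one fact: the characteristic function of this sum differs from
  \<open>exp (- (s\<^sup>2 + t\<^sup>2 + 2 s t \<rho>(n, m)) / 2)\<close> by a quantity that tends to \<open>0\<close> as \<open>n\<close> and \<open>m\<close> grow,
  whatever the correlations do, and uniformly for bounded \<open>s\<close> and \<open>t\<close>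
  (\<open>joint_characteristic_function_asymptotics\<close>). It is Lindeberg's argument: the pairs are not
  identically distributed, but each coordinate is, so the Lindeberg terms of the two coordinates
  can be bounded separately by dominated convergence.

  If \<open>\<rho>(n, m)\<close> tends to \<open>0\<close>, constant \<open>s\<close>, \<open>t\<close> give the limit \<open>exp (- s\<^sup>2 / 2) exp (- t\<^sup>2 / 2)\<close>, which
  by a continuity theorem for characteristic functions in the plane (\<open>levy_continuity_plane\<close>) is
  statement (c). The standardized difference of means is \<open>\<alpha> Y1 n + \<beta> Y2 m\<close> with \<open>\<alpha>\<^sup>2 + \<beta>\<^sup>2 = 1\<close>,
  where \<open>\<alpha>\<close> and \<open>\<beta>\<close> vary with \<open>(n, m)\<close>, in general without a limit; uniformity in \<open>s\<close> and \<open>t\<close> gives (d) from the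
  one-dimensional continuity theorem.

  Conversely, on the diagonal \<open>n = m\<close> the difference has constant nonzero weights, so that either
  of (c) and (d) determines the limit of the expectation of \<open>cos (s Y1 k + t Y2 k)\<close> for one
  pair \<open>s\<close>, \<open>t\<close> with \<open>s t \<noteq> 0\<close>. Comparing with the exponential above forces \<open>\<rho>(k, k) \<longlongrightarrow> 0\<close>
  (\<open>sum_correlation_tendsto_0_if_cos_expectation\<close>), which is (b). Finally (b) is (a) on the diagonal, and
  \<open>\<bar>\<rho>(n, m)\<bar>\<close> is at most \<open>\<bar>\<rho>(k, k)\<bar>\<close> for \<open>k = min n m\<close>, so the two are equivalent.
\<close>

section \<open>Continuity of characteristic functions in the plane\<close>

text \<open>
  A bounded weight \<open>w \<ge> 1\<close> can be normalized to a probability density, so the one-dimensional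
  continuity theorem also applies to weighted laws. The lower bound on \<open>w\<close> keeps the
  normalizing constants away from \<open>0\<close>; any bounded weight is brought to this form by adding a
  constant.
\<close>

lemma levy_continuity_weighted:
  fixes N :: "nat \<Rightarrow> 'a measure" and Z w :: "'a \<Rightarrow> real" and c B :: real
  assumes N: "\<And>k. prob_space (N k)"
    and Z [measurable]: "\<And>k. Z \<in> borel_measurable (N k)"
    and w [measurable]: "\<And>k. w \<in> borel_measurable (N k)"
    and w_bounds: "\<And>x. 1 \<le> w x" "\<And>x. w x \<le> B"
    and \<mu>: "real_distribution \<mu>"
    and char_lim: "\<And>s. (\<lambda>k. CLINT x|N k. w x *\<^sub>R iexp (s * Z x)) \<longlonglongrightarrow> c * char \<mu> s"
    and f: "continuous_on UNIV f" "bounded (range f)"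
  shows "(\<lambda>k. LINT x|N k. w x * f (Z x)) \<longlonglongrightarrow> c * (LINT x|\<mu>. f x)"
proof -
  interpret \<mu>: real_distribution \<mu> by fact
  define e where "e k = (LINT x|N k. w x)" for k
  define Q where "Q k = distr (density (N k) (\<lambda>x. ennreal (w x / e k))) borel Z" for k
  have [measurable]: "f \<in> borel_measurable borel"
    using f(1) by (rule borel_measurable_continuous_onI)
  have w_int: "integrable (N k) w" for k
  proof -
    interpret prob_space "N k" by (rule N)
    have "\<bar>w x\<bar> \<le> B" for x
      using w_bounds[of x] by simp
    then show ?thesis
      by (intro integrable_const_bound[where B=B] AE_I2) auto
  qed
  have e_ge: "e k \<ge> 1" for k
  proof -
    interpret prob_space "N k" by (rule N)
    have "(LINT x|N k. 1) \<le> e k"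
      unfolding e_def using w_bounds w_int by (intro integral_mono) auto
    then show ?thesis by (simp add: prob_space)
  qed
  have w_nn: "0 \<le> w x / e k" for x k
    using w_bounds(1)[of x] e_ge[of k] by simp
  have Q_integral: "integral\<^sup>L (Q k) g = (LINT x|N k. w x *\<^sub>R g (Z x)) /\<^sub>R e k"
    if [measurable]: "g \<in> borel_measurable borel"
    for g :: "real \<Rightarrow> 'b::{banach, second_countable_topology}" and k
  proof -
    have "integral\<^sup>L (Q k) g = (LINT x|N k. (w x / e k) *\<^sub>R g (Z x))"
      unfolding Q_def by (subst integral_distr) (auto simp: integral_density w_nn)
    also have "\<dots> = (LINT x|N k. (1 / e k) *\<^sub>R (w x *\<^sub>R g (Z x)))"
      by (simp add: mult.commute)
    also have "\<dots> = (LINT x|N k. w x *\<^sub>R g (Z x)) /\<^sub>R e k"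
      by (subst integral_scaleR_right) (simp_all add: inverse_eq_divide)
    finally show ?thesis .
  qed
  have Q: "real_distribution (Q k)" for k
  proof -
    interpret prob_space "N k" by (rule N)
    have "(\<integral>\<^sup>+ x. ennreal (w x / e k) \<partial>N k) = ennreal (LINT x|N k. w x / e k)"
      using w_int w_nn by (intro nn_integral_eq_integral) auto
    also have "(LINT x|N k. w x / e k) = 1"
      using e_ge[of k] by (simp add: e_def)
    finally have "prob_space (density (N k) (\<lambda>x. ennreal (w x / e k)))"
      by (intro prob_spaceI) (simp add: emeasure_density cong: nn_integral_cong)
    then interpret D: prob_space "density (N k) (\<lambda>x. ennreal (w x / e k))" .
    show ?thesis unfolding Q_def by (rule D.real_distribution_distr) simp
  qed
  have e_lim: "e \<longlonglongrightarrow> c"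
  proof -
    have "(\<lambda>k. CLINT x|N k. complex_of_real (w x)) \<longlonglongrightarrow> c"
      using char_lim[of 0] by (simp add: \<mu>.char_zero scaleR_conv_of_real)
    then have "(\<lambda>k. complex_of_real (e k)) \<longlonglongrightarrow> c"
      by (simp add: e_def)
    then show ?thesis by (simp add: tendsto_of_real_iff)
  qed
  have "c \<ge> 1"
    using e_ge by (intro tendsto_lowerbound[OF e_lim]) auto
  have char_Q: "(\<lambda>k. char (Q k) s) \<longlonglongrightarrow> char \<mu> s" for s
  proof -
    have "(\<lambda>k. (CLINT x|N k. w x *\<^sub>R iexp (s * Z x)) /\<^sub>R e k) \<longlonglongrightarrow> (c * char \<mu> s) /\<^sub>R c"
      using \<open>c \<ge> 1\<close> by (intro tendsto_intros char_lim e_lim) auto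
    also have "(c * char \<mu> s) /\<^sub>R c = char \<mu> s"
      using \<open>c \<ge> 1\<close> by (simp add: scaleR_conv_of_real)
    also have "(\<lambda>k. (CLINT x|N k. w x *\<^sub>R iexp (s * Z x)) /\<^sub>R e k) = (\<lambda>k. char (Q k) s)"
      unfolding char_def by (subst Q_integral) auto
    finally show ?thesis .
  qed
  obtain K where K: "\<And>x. norm (f x) \<le> K"
    using f(2) unfolding bounded_iff by auto
  have "weak_conv_m Q \<mu>"
    using Q \<mu> char_Q by (rule levy_continuity)
  then have "(\<lambda>k. integral\<^sup>L (Q k) f) \<longlonglongrightarrow> integral\<^sup>L \<mu> f"
    using f(1) K Q \<mu>
    by (intro weak_conv_imp_integral_bdd_continuous_conv) (auto simp: continuous_on_eq_continuous_at)
  then have "(\<lambda>k. e k * integral\<^sup>L (Q k) f) \<longlonglongrightarrow> c * integral\<^sup>L \<mu> f"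
    by (intro tendsto_mult e_lim)
  moreover have "e k * integral\<^sup>L (Q k) f = (LINT x|N k. w x * f (Z x))" for k
    using e_ge[of k] by (subst Q_integral) auto
  ultimately show ?thesis by simp
qed

lemma char_uminus: "char \<mu> (- t) = cnj (char \<mu> t)"
proof -
  have "cnj (char \<mu> t) = (CLINT x|\<mu>. cnj (iexp (t * x)))"
    by (simp add: char_def)
  then show ?thesis
    by (simp add: char_def exp_cnj)
qed

text \<open>
  Only the one-dimensional theorem is used, once for each coordinate. Weighting the first
  coordinate by a trigonometric function of the second replaces the exponential \<open>iexp (s x)\<close> by
  an arbitrary \<open>f x\<close>; weighting the second coordinate by this \<open>f\<close> then replaces \<open>iexp (t y)\<close> by \<open>g y\<close>.
\<close>

lemma levy_continuity_product_functions:
  fixes P :: "nat \<Rightarrow> (real \<times> real) measure"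
  assumes P: "\<And>k. prob_space (P k)" and P_sets: "\<And>k. sets (P k) = sets borel"
    and \<mu>: "real_distribution \<mu>" and \<nu>: "real_distribution \<nu>"
    and char_lim: "\<And>s t. (\<lambda>k. CLINT z|P k. iexp (s * fst z + t * snd z)) \<longlonglongrightarrow> char \<mu> s * char \<nu> t"
    and f: "continuous_on UNIV f" "bounded (range f)"
    and g: "continuous_on UNIV g" "bounded (range g)"
  shows "(\<lambda>k. LINT z|P k. f (fst z) * g (snd z)) \<longlonglongrightarrow> (LINT x|\<mu>. f x) * (LINT y|\<nu>. g y :: real)"
proof -
  interpret \<mu>: real_distribution \<mu> by fact
  interpret \<nu>: real_distribution \<nu> by fact
  have [measurable]: "f \<in> borel_measurable borel" "g \<in> borel_measurable borel"
    using f(1) g(1) by (auto intro: borel_measurable_continuous_onI)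
  have [measurable_cong]: "sets (P k) = sets (borel \<Otimes>\<^sub>M borel :: (real \<times> real) measure)" for k
    unfolding borel_prod by (rule P_sets)
  obtain K where K: "\<And>x. \<bar>f x\<bar> \<le> K"
    using f(2) unfolding bounded_iff by auto
  obtain L where L: "\<And>x. \<bar>g x\<bar> \<le> L"
    using g(2) unfolding bounded_iff by auto
  have bdd_integrable: "integrable (P k) h" if "h \<in> borel_measurable (P k)" "\<And>z. norm (h z) \<le> C"
    for h :: "real \<times> real \<Rightarrow> 'b::{banach, second_countable_topology}" and C k
  proof -
    interpret prob_space "P k" by (rule P)
    show ?thesis using that by (intro integrable_const_bound[where B=C]) auto
  qed
  have int_iexp [intro]: "integrable (P k) (\<lambda>z. iexp (s * fst z + t * snd z))" for s t k
    by (rule bdd_integrable[of _ _ 1]) auto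
  have f_fst: "(\<lambda>k. LINT z|P k. f (fst z)) \<longlonglongrightarrow> (LINT x|\<mu>. f x)"
    using levy_continuity_weighted[where N=P and Z=fst and w="\<lambda>_. 1" and B=1 and c=1, OF P _ _ _ _ \<mu> _ f]
      char_lim[of _ 0] by (simp add: \<nu>.char_zero)
  have g_snd: "(\<lambda>k. LINT z|P k. g (snd z)) \<longlonglongrightarrow> (LINT x|\<nu>. g x)"
    using levy_continuity_weighted[where N=P and Z=snd and w="\<lambda>_. 1" and B=1 and c=1, OF P _ _ _ _ \<nu> _ g]
      char_lim[of 0] by (simp add: \<mu>.char_zero)
  \<comment> \<open>The weight is \<open>2 + Re (a * iexp (t * y))\<close>; taking \<open>a = 1\<close> and \<open>a = - \<i>\<close> yields cosine and sine of \<open>t * y\<close>.\<close>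
  have trig: "(\<lambda>k. LINT z|P k. Re (a * iexp (t * snd z)) * f (fst z)) \<longlonglongrightarrow> Re (a * char \<nu> t) * (LINT x|\<mu>. f x)"
    if a: "cmod a = 1" for a t
  proof -
    define w where "w z = 2 + Re (a * iexp (t * snd z))" for z :: "real \<times> real"
    have Re_le: "\<bar>Re (a * iexp (t * y))\<bar> \<le> 1" for y
      using abs_Re_le_cmod[of "a * iexp (t * y)"] a by (simp add: norm_mult)
    have "(\<lambda>k. CLINT z|P k. w z *\<^sub>R iexp (s * fst z)) \<longlonglongrightarrow> complex_of_real (2 + Re (a * char \<nu> t)) * char \<mu> s" for s
    proof -
      have eq: "w z *\<^sub>R iexp (s * fst z) = 2 * iexp (s * fst z + 0 * snd z)
          + (a / 2 * iexp (s * fst z + t * snd z) + cnj a / 2 * iexp (s * fst z + (- t) * snd z))" for z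
      proof -
        have split: "iexp (s * fst z + u * snd z) = iexp (s * fst z) * iexp (u * snd z)" for u
          by (simp add: ring_distribs exp_add)
        have "complex_of_real (Re (a * iexp (t * snd z))) = (a * iexp (t * snd z) + cnj (a * iexp (t * snd z))) / 2"
          by (simp add: complex_eq_iff)
        also have "cnj (a * iexp (t * snd z)) = cnj a * iexp (- t * snd z)"
          by (simp add: exp_cnj)
        finally have "w z *\<^sub>R iexp (s * fst z) =
            (2 + (a * iexp (t * snd z) + cnj a * iexp (- t * snd z)) / 2) * iexp (s * fst z)"
          unfolding w_def scaleR_conv_of_real of_real_add of_real_numeral by (rule arg_cong)
        also have "\<dots> = 2 * iexp (s * fst z + 0 * snd z)
            + (a / 2 * iexp (s * fst z + t * snd z) + cnj a / 2 * iexp (s * fst z + (- t) * snd z))"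
          unfolding split by (simp add: field_simps)
        finally show ?thesis .
      qed
      have "(CLINT z|P k. w z *\<^sub>R iexp (s * fst z)) =
          2 * (CLINT z|P k. iexp (s * fst z + 0 * snd z))
          + (a / 2 * (CLINT z|P k. iexp (s * fst z + t * snd z))
             + cnj a / 2 * (CLINT z|P k. iexp (s * fst z + (- t) * snd z)))" for k
        unfolding eq
        by (subst Bochner_Integration.integral_add Bochner_Integration.integral_mult_right
              | intro Bochner_Integration.integrable_add integrable_mult_right int_iexp impI | rule refl)+
      moreover have "(\<lambda>k. 2 * (CLINT z|P k. iexp (s * fst z + 0 * snd z))
          + (a / 2 * (CLINT z|P k. iexp (s * fst z + t * snd z))
             + cnj a / 2 * (CLINT z|P k. iexp (s * fst z + (- t) * snd z))))
          \<longlonglongrightarrow> 2 * (char \<mu> s * char \<nu> 0) + (a / 2 * (char \<mu> s * char \<nu> t) + cnj a / 2 * (char \<mu> s * char \<nu> (- t)))"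
        by (intro tendsto_intros char_lim)
      moreover have "2 * (char \<mu> s * char \<nu> 0) + (a / 2 * (char \<mu> s * char \<nu> t) + cnj a / 2 * (char \<mu> s * char \<nu> (- t)))
          = complex_of_real (2 + Re (a * char \<nu> t)) * char \<mu> s"
      proof -
        have "complex_of_real (Re (a * char \<nu> t)) = (a * char \<nu> t + cnj a * char \<nu> (- t)) / 2"
          by (simp add: complex_eq_iff char_uminus)
        then show ?thesis
          unfolding of_real_add of_real_numeral by (simp only: \<nu>.char_zero) (simp add: field_simps)
      qed
      ultimately show ?thesis by simp
    qed
    then have "(\<lambda>k. LINT z|P k. w z * f (fst z)) \<longlonglongrightarrow> (2 + Re (a * char \<nu> t)) * (LINT x|\<mu>. f x)"
    proof (intro levy_continuity_weighted[where B=3] P \<mu> f)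
      show "1 \<le> w z" "w z \<le> 3" for z
        using Re_le[of "snd z"] unfolding w_def by linarith+
    qed (auto simp: w_def)
    moreover have "(LINT z|P k. w z * f (fst z)) = 2 * (LINT z|P k. f (fst z)) + (LINT z|P k. Re (a * iexp (t * snd z)) * f (fst z))" for k
    proof -
      have "integrable (P k) (\<lambda>z. Re (a * iexp (t * snd z)) * f (fst z))"
      proof (rule bdd_integrable)
        show "norm (Re (a * iexp (t * snd z)) * f (fst z)) \<le> 1 * K" for z
          unfolding real_norm_def abs_mult by (intro mult_mono Re_le K) auto
      qed simp
      moreover have "integrable (P k) (\<lambda>z. f (fst z))"
        using K by (intro bdd_integrable[of _ _ K]) auto
      ultimately show ?thesis
        unfolding w_def ring_distribs by (subst Bochner_Integration.integral_add) auto
    qed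
    ultimately have "(\<lambda>k. (2 * (LINT z|P k. f (fst z)) + (LINT z|P k. Re (a * iexp (t * snd z)) * f (fst z))) - 2 * (LINT z|P k. f (fst z)))
       \<longlonglongrightarrow> (2 + Re (a * char \<nu> t)) * (LINT x|\<mu>. f x) - 2 * (LINT x|\<mu>. f x)"
      by (intro tendsto_intros f_fst) simp
    then show ?thesis by (simp add: ring_distribs)
  qed
  have f_iexp: "(\<lambda>k. CLINT z|P k. f (fst z) *\<^sub>R iexp (t * snd z)) \<longlonglongrightarrow> (LINT x|\<mu>. f x) * char \<nu> t" for t
  proof -
    have "integrable (P k) (\<lambda>z. f (fst z) *\<^sub>R iexp (t * snd z))" for k
      using K by (intro bdd_integrable[of _ _ K]) auto
    then have "Re (CLINT z|P k. f (fst z) *\<^sub>R iexp (t * snd z)) = (LINT z|P k. Re (1 * iexp (t * snd z)) * f (fst z))"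
       "Im (CLINT z|P k. f (fst z) *\<^sub>R iexp (t * snd z)) = (LINT z|P k. Re (- \<i> * iexp (t * snd z)) * f (fst z))" for k
      by (auto simp flip: integral_Re integral_Im simp: mult.commute intro!: Bochner_Integration.integral_cong)
    then show ?thesis
      using trig[of 1 t] trig[of "- \<i>" t]
      by (simp add: tendsto_complex_iff mult.commute del: integral_Re integral_Im)
  qed
  \<comment> \<open>\<open>K\<close> bounds \<open>\<bar>f\<bar>\<close>, so this is a weight that is at least \<open>1\<close>.\<close>
  define w where "w z = f (fst z) + K + 1" for z :: "real \<times> real"
  have int_f: "integrable (P k) (\<lambda>z. f (fst z) *\<^sub>R h z)"
    if "\<And>z. norm (h z) \<le> C" "h \<in> borel_measurable (P k)" for h :: "real \<times> real \<Rightarrow> 'b::{banach, second_countable_topology}" and C k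
    using K that by (intro bdd_integrable[of _ _ "K * C"]) (auto intro!: mult_mono order_trans[OF abs_ge_zero K])
  have "(\<lambda>k. CLINT z|P k. w z *\<^sub>R iexp (t * snd z)) \<longlonglongrightarrow> complex_of_real ((LINT x|\<mu>. f x) + K + 1) * char \<nu> t" for t
  proof -
    have "integrable (P k) (\<lambda>z. iexp (t * snd z))" for k
      using int_iexp[of k 0 t] by simp
    then have "(CLINT z|P k. w z *\<^sub>R iexp (t * snd z)) =
       (CLINT z|P k. f (fst z) *\<^sub>R iexp (t * snd z)) + (K + 1) *\<^sub>R (CLINT z|P k. iexp (0 * fst z + t * snd z))" for k
      unfolding w_def add.assoc scaleR_add_left[of _ "K + 1"]
      by (subst Bochner_Integration.integral_add) (auto intro!: int_f[of _ 1] simp del: scaleR_conv_of_real)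
    moreover have "(\<lambda>k. (CLINT z|P k. f (fst z) *\<^sub>R iexp (t * snd z)) + (K + 1) *\<^sub>R (CLINT z|P k. iexp (0 * fst z + t * snd z)))
       \<longlonglongrightarrow> (LINT x|\<mu>. f x) * char \<nu> t + (K + 1) *\<^sub>R (char \<mu> 0 * char \<nu> t)"
      by (intro tendsto_intros f_iexp char_lim)
    ultimately show ?thesis by (simp add: \<mu>.char_zero scaleR_conv_of_real ring_distribs add.assoc)
  qed
  then have "(\<lambda>k. LINT z|P k. w z * g (snd z)) \<longlonglongrightarrow> ((LINT x|\<mu>. f x) + K + 1) * (LINT x|\<nu>. g x)"
  proof (intro levy_continuity_weighted[where B="2 * K + 1"] P \<nu> g)
    show "1 \<le> w z" "w z \<le> 2 * K + 1" for z
      using K[of "fst z"] by (auto simp: w_def)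
  qed (auto simp: w_def)
  moreover have "(LINT z|P k. w z * g (snd z)) = (LINT z|P k. f (fst z) * g (snd z)) + (K + 1) * (LINT z|P k. g (snd z))" for k
  proof -
    have "integrable (P k) (\<lambda>z. f (fst z) * g (snd z))"
      using int_f[of "\<lambda>z. g (snd z)" L] L by simp
    moreover have "integrable (P k) (\<lambda>z. g (snd z))"
      using L by (intro bdd_integrable[of _ _ L]) auto
    ultimately show ?thesis
      unfolding w_def add.assoc distrib_right[of _ "K + 1"] by (subst Bochner_Integration.integral_add) auto
  qed
  ultimately have "(\<lambda>k. ((LINT z|P k. f (fst z) * g (snd z)) + (K + 1) * (LINT z|P k. g (snd z))) - (K + 1) * (LINT z|P k. g (snd z)))
     \<longlonglongrightarrow> ((LINT x|\<mu>. f x) + K + 1) * (LINT x|\<nu>. g x) - (K + 1) * (LINT x|\<nu>. g x)"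
    by (intro tendsto_intros g_snd) simp
  then show ?thesis by (simp add: ring_distribs)
qed


lemma (in pair_sigma_finite) integral_fst_times_snd:
  fixes f :: "'a \<Rightarrow> real" and g :: "'b \<Rightarrow> real"
  assumes "integrable (M1 \<Otimes>\<^sub>M M2) (\<lambda>z. f (fst z) * g (snd z))"
  shows "(LINT z|(M1 \<Otimes>\<^sub>M M2). f (fst z) * g (snd z)) = (LINT x|M1. f x) * (LINT y|M2. g y)"
  using integral_fst'[OF assms] by simp

text \<open>
  The algebra of finite sums of products of one-variable functions: its members can be integrated
  by \<open>levy_continuity_product_functions\<close>, and it satisfies the hypotheses of the
  Stone-Weierstrass theorem.
\<close>

inductive sum_of_products :: "(real \<times> real \<Rightarrow> real) \<Rightarrow> bool" where
  product: "continuous_on UNIV f \<Longrightarrow> continuous_on UNIV g \<Longrightarrow> sum_of_products (\<lambda>z. f (fst z) * g (snd z))"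
| add: "sum_of_products p \<Longrightarrow> sum_of_products q \<Longrightarrow> sum_of_products (\<lambda>z. p z + q z)"

lemma sum_of_products_mult:
  assumes "sum_of_products p" "sum_of_products q"
  shows "sum_of_products (\<lambda>z. p z * q z)"
  using assms
proof (induction p)
  case (product f g)
  show ?case using product(3)
  proof (induction q)
    case (product f' g')
    have "sum_of_products (\<lambda>z. (f (fst z) * f' (fst z)) * (g (snd z) * g' (snd z)))"
      using \<open>continuous_on UNIV f\<close> \<open>continuous_on UNIV g\<close> product
      by (intro sum_of_products.product[of "\<lambda>x. f x * f' x" "\<lambda>x. g x * g' x"] continuous_intros)
    then show ?case by (simp add: mult_ac)
  next
    case (add p q)
    then show ?case using sum_of_products.add[OF add.IH] by (simp add: ring_distribs)
  qed
next
  case (add p p')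
  then show ?case by (auto simp: ring_distribs intro!: sum_of_products.add)
qed

lemma sum_of_products_continuous: "sum_of_products p \<Longrightarrow> continuous_on S p"
proof (induction rule: sum_of_products.induct)
  case (product f g)
  show ?case
    by (intro continuous_intros continuous_on_compose2[OF product(1)] continuous_on_compose2[OF product(2)]) auto
qed (intro continuous_intros)

lemma sum_of_products_dense:
  fixes F :: "real \<times> real \<Rightarrow> real"
  assumes "compact S" "continuous_on S F" "0 < e"
  obtains p where "sum_of_products p" "\<And>z. z \<in> S \<Longrightarrow> \<bar>F z - p z\<bar> < e"
proof -
  have const: "sum_of_products (\<lambda>_. c)" for c
    using sum_of_products.product[of "\<lambda>_. c" "\<lambda>_. 1"] by simp
  have coords: "sum_of_products fst" "sum_of_products snd"
    using sum_of_products.product[of "\<lambda>x. x" "\<lambda>_. 1"] sum_of_products.product[of "\<lambda>_. 1" "\<lambda>x. x"]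
    by (simp_all add: fun_eq_iff)
  have "\<exists>p. sum_of_products p \<and> (\<forall>z\<in>S. \<bar>F z - p z\<bar> < e)"
  proof (rule Stone_Weierstrass_HOL[OF assms(1), where P=sum_of_products])
    show "\<exists>f. sum_of_products f \<and> f x \<noteq> f y" if "x \<in> S \<and> y \<in> S \<and> x \<noteq> y" for x y
      using that coords by (metis prod_eqI)
  qed (auto intro: const sum_of_products_continuous sum_of_products.add sum_of_products_mult assms)
  with that show ?thesis by blast
qed

definition truncation :: "real \<Rightarrow> real \<Rightarrow> real" where
  "truncation R x = max (- R) (min R x)"

text \<open>
  A continuous function that is \<open>1\<close> outside \<open>{-R..R}\<close> and \<open>0\<close> on \<open>{1-R..R-1}\<close>, so that its
  expectation bounds a tail probability and is still controlled by weak convergence.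
\<close>

definition tail_bump :: "real \<Rightarrow> real \<Rightarrow> real" where
  "tail_bump R x = max 0 (min 1 (\<bar>x\<bar> - R + 1))"

lemma continuous_truncation [continuous_intros]: "continuous_on S (truncation R)"
  and continuous_tail_bump [continuous_intros]: "continuous_on S (tail_bump R)"
  unfolding truncation_def tail_bump_def by (intro continuous_intros)+

lemma tail_bump_bounds: "0 \<le> tail_bump R x" "tail_bump R x \<le> 1"
  by (auto simp: tail_bump_def)

lemma integral_tail_bump_tendsto:
  assumes "real_distribution \<mu>"
  shows "(\<lambda>n. LINT x|\<mu>. tail_bump (real n) x) \<longlonglongrightarrow> 0"
proof -
  interpret real_distribution \<mu> by fact
  have [measurable]: "tail_bump R \<in> borel_measurable borel" for R
    by (intro borel_measurable_continuous_onI continuous_intros)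
  have "(\<lambda>n. tail_bump (real n) x) \<longlonglongrightarrow> 0" for x
  proof (rule tendsto_eventually, rule eventually_sequentiallyI)
    fix n assume "nat \<lceil>\<bar>x\<bar> + 1\<rceil> \<le> n"
    then have "\<bar>x\<bar> + 1 \<le> real n" by (simp only: nat_ceiling_le_eq)
    then show "tail_bump (real n) x = 0" by (simp add: tail_bump_def)
  qed
  then have "(\<lambda>n. LINT x|\<mu>. tail_bump (real n) x) \<longlonglongrightarrow> (LINT x|\<mu>. 0)"
    by (intro integral_dominated_convergence[where w="\<lambda>_. 1"]) (auto simp: tail_bump_bounds abs_le_iff intro!: order_trans[OF _ tail_bump_bounds(1)])
  then show ?thesis by simp
qed

text \<open>
  Tightness comes for free from the marginals: the expectation of the two tail bumps converges to a
  limit that is small for large \<open>R\<close>. On the box of half-width \<open>R\<close>, the function \<open>F\<close> is uniformly close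
  to a sum of products \<open>p\<close>; precomposing \<open>p\<close> with the truncation to the box leaves it a sum of
  products, now bounded, whose integrals converge.
\<close>

lemma levy_continuity_plane:
  fixes P :: "nat \<Rightarrow> (real \<times> real) measure" and F :: "real \<times> real \<Rightarrow> real"
  assumes P: "\<And>k. prob_space (P k)" and P_sets: "\<And>k. sets (P k) = sets borel"
    and \<mu>: "real_distribution \<mu>" and \<nu>: "real_distribution \<nu>"
    and char_lim: "\<And>s t. (\<lambda>k. CLINT z|P k. iexp (s * fst z + t * snd z)) \<longlonglongrightarrow> char \<mu> s * char \<nu> t"
    and F: "continuous_on UNIV F" "bounded (range F)"
  shows "(\<lambda>k. integral\<^sup>L (P k) F) \<longlonglongrightarrow> integral\<^sup>L (\<mu> \<Otimes>\<^sub>M \<nu>) F"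
proof -
  interpret \<mu>: real_distribution \<mu> by fact
  interpret \<nu>: real_distribution \<nu> by fact
  interpret prod: pair_prob_space \<mu> \<nu> ..
  let ?Q = "\<mu> \<Otimes>\<^sub>M \<nu>"
  have Q_sets: "sets ?Q = sets borel"
    by (subst borel_prod[symmetric]) (intro sets_pair_measure_cong, simp_all)
  obtain B where B: "\<And>z. \<bar>F z\<bar> \<le> B"
    using F(2) unfolding bounded_iff by auto
  have "B \<ge> 0" using B[of 0] by linarith
  have bdd_integrable: "integrable N h"
    if "prob_space N" "sets N = sets borel" "continuous_on UNIV h" "\<And>z. \<bar>h z\<bar> \<le> C"
    for N and h :: "real \<times> real \<Rightarrow> real" and C
  proof -
    interpret prob_space N by (rule that)
    have "h \<in> borel_measurable N"
      using borel_measurable_continuous_onI[OF that(3)] measurable_cong_sets[OF that(2) refl] by blast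
    then show ?thesis using that(4) by (intro integrable_const_bound[where B=C]) auto
  qed
  define clip :: "real \<Rightarrow> real \<times> real \<Rightarrow> real \<times> real"
    where "clip R z = (truncation R (fst z), truncation R (snd z))" for R z
  have clip_continuous: "continuous_on UNIV (\<lambda>z. h (clip R z))"
    if "continuous_on UNIV h" for h :: "real \<times> real \<Rightarrow> real" and R
    unfolding clip_def
    by (intro continuous_on_compose2[OF that] continuous_intros continuous_on_compose2[OF continuous_truncation]) auto
  have clip_box: "clip R z \<in> cbox (- R, - R) (R, R)" if "R \<ge> 0" for R z
    using that by (auto simp: clip_def truncation_def cbox_Pair_eq)
  have clip_integrable: "integrable N (\<lambda>z. h (clip R z))"
    if N: "prob_space N" "sets N = sets borel" and "continuous_on UNIV h" "R \<ge> 0"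
    for N and h :: "real \<times> real \<Rightarrow> real" and R
  proof -
    have "compact (h ` cbox (- R, - R) (R, R))"
      using that(3) by (intro compact_continuous_image compact_cbox) (auto intro: continuous_on_subset)
    then have "bounded (h ` cbox (- R, - R) (R, R))"
      by (rule compact_imp_bounded)
    then obtain C where C: "\<forall>y \<in> h ` cbox (- R, - R) (R, R). norm y \<le> C"
      unfolding bounded_iff ..
    have "\<bar>h (clip R z)\<bar> \<le> C" for z
      using C[rule_format, OF imageI, OF clip_box[OF that(4)]] by simp
    then show ?thesis
      by (rule bdd_integrable[OF N clip_continuous[OF that(3)]])
  qed
  have one_dim: "continuous_on UNIV (\<lambda>x. f (truncation R x)) \<and> bounded (range (\<lambda>x. f (truncation R x)))"
    if "continuous_on UNIV f" "R \<ge> 0" for f :: "real \<Rightarrow> real" and R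
  proof
    show "continuous_on UNIV (\<lambda>x. f (truncation R x))"
      by (rule continuous_on_compose2[OF that(1) continuous_truncation]) simp
    have "range (\<lambda>x. f (truncation R x)) \<subseteq> f ` {-R..R}"
      using that(2) by (auto simp: truncation_def)
    moreover have "bounded (f ` {-R..R})"
      using that(1) by (intro compact_imp_bounded compact_continuous_image) (auto intro: continuous_on_subset)
    ultimately show "bounded (range (\<lambda>x. f (truncation R x)))"
      by (rule bounded_subset[rotated])
  qed
  have prod_lim: "(\<lambda>k. LINT z|P k. f (fst z) * g (snd z)) \<longlonglongrightarrow> (LINT z|?Q. f (fst z) * g (snd z))"
    if f: "continuous_on UNIV f" "bounded (range f)" and g: "continuous_on UNIV g" "bounded (range g)"
    for f g :: "real \<Rightarrow> real"
  proof -
    obtain K L where K: "\<And>x. \<bar>f x\<bar> \<le> K" and L: "\<And>x. \<bar>g x\<bar> \<le> L"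
      using f(2) g(2) unfolding bounded_iff by auto
    have "\<bar>f (fst z) * g (snd z)\<bar> \<le> K * L" for z :: "real \<times> real"
      unfolding abs_mult by (intro mult_mono K L order_trans[OF abs_ge_zero K]) auto
    then have "integrable ?Q (\<lambda>z. f (fst z) * g (snd z))"
      by (intro bdd_integrable[of ?Q _ "K * L"] prod.prob_space_axioms Q_sets continuous_intros
            continuous_on_compose2[OF f(1)] continuous_on_compose2[OF g(1)]) auto
    from prod.integral_fst_times_snd[OF this]
    show ?thesis
      using levy_continuity_product_functions[OF P P_sets \<mu> \<nu> char_lim f g] by simp
  qed
  have clipped_lim: "(\<lambda>k. LINT z|P k. p (clip R z)) \<longlonglongrightarrow> (LINT z|?Q. p (clip R z))"
    if "sum_of_products p" "R \<ge> 0" for p R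
    using that(1)
  proof (induction rule: sum_of_products.induct)
    case (product f g)
    show ?case
      using prod_lim[of "\<lambda>x. f (truncation R x)" "\<lambda>x. g (truncation R x)"]
        one_dim[OF product(1) that(2)] one_dim[OF product(2) that(2)]
      by (simp add: clip_def)
  next
    case (add p q)
    have "integrable N (\<lambda>z. p (clip R z))" "integrable N (\<lambda>z. q (clip R z))"
      if "prob_space N" "sets N = sets borel" for N
      using clip_integrable[OF that] sum_of_products_continuous add(1,2) \<open>R \<ge> 0\<close> by blast+
    then show ?case
      using add.IH P P_sets prod.prob_space_axioms Q_sets
      by (simp add: tendsto_add)
  qed
  define T where "T R z = tail_bump R (fst z) + tail_bump R (snd z)" for R and z :: "real \<times> real"
  have T_nonneg: "0 \<le> T R z" for R z
    using tail_bump_bounds by (simp add: T_def)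
  have T_integrable: "integrable N (\<lambda>z. tail_bump R (fst z))" "integrable N (\<lambda>z. tail_bump R (snd z))"
    "integrable N (T R)" if "prob_space N" "sets N = sets borel" for N R
  proof -
    show *: "integrable N (\<lambda>z. tail_bump R (fst z))" "integrable N (\<lambda>z. tail_bump R (snd z))"
      using tail_bump_bounds that
      by (auto intro!: bdd_integrable[of N _ 1] continuous_intros continuous_on_compose2[OF continuous_tail_bump])
    show "integrable N (T R)"
      unfolding T_def using * by (rule Bochner_Integration.integrable_add)
  qed
  have tail_bump_fun: "continuous_on UNIV (tail_bump R)" "bounded (range (tail_bump R))" for R
    using tail_bump_bounds by (auto intro!: continuous_intros boundedI[where B=1] simp: abs_le_iff)
  have T_lim: "(\<lambda>k. integral\<^sup>L (P k) (T R)) \<longlonglongrightarrow> integral\<^sup>L ?Q (T R)"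
    and T_Q: "integral\<^sup>L ?Q (T R) = (LINT x|\<mu>. tail_bump R x) + (LINT x|\<nu>. tail_bump R x)" for R
  proof -
    have split: "integral\<^sup>L N (T R) = (LINT z|N. tail_bump R (fst z)) + (LINT z|N. tail_bump R (snd z))"
      if "prob_space N" "sets N = sets borel" for N
      unfolding T_def using T_integrable[OF that] by (intro Bochner_Integration.integral_add)
    show "(\<lambda>k. integral\<^sup>L (P k) (T R)) \<longlonglongrightarrow> integral\<^sup>L ?Q (T R)"
      using prod_lim[of "tail_bump R" "\<lambda>_. 1"] prod_lim[of "\<lambda>_. 1" "tail_bump R"]
      by (auto simp: split[OF P P_sets] split[OF prod.prob_space_axioms Q_sets] tail_bump_fun intro!: tendsto_add)
    show "integral\<^sup>L ?Q (T R) = (LINT x|\<mu>. tail_bump R x) + (LINT x|\<nu>. tail_bump R x)"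
      using prod.integral_fst_times_snd[of "tail_bump R" "\<lambda>_. 1"] prod.integral_fst_times_snd[of "\<lambda>_. 1" "tail_bump R"]
        T_integrable[OF prod.prob_space_axioms Q_sets, of R]
      by (simp add: split[OF prod.prob_space_axioms Q_sets] \<mu>.prob_space[simplified] \<nu>.prob_space[simplified])
  qed
  show ?thesis
  proof (rule tendstoI)
    fix e :: real assume "e > 0"
    \<comment> \<open>The tail integral will be below \<open>3 * d\<close> under \<open>P k\<close> and below \<open>2 * d\<close> under the limit, both entering with factor \<open>2 * B\<close>; replacing \<open>F\<close> by \<open>p\<close> twice and passing to the limit once add less than \<open>4 * d\<close>.\<close>
    define d where "d = e / (4 + 10 * B)"
    have "d > 0" using \<open>e > 0\<close> \<open>B \<ge> 0\<close> by (simp add: d_def)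
    have "\<forall>\<^sub>F n in sequentially. (LINT x|\<mu>. tail_bump (real n) x) < d \<and> (LINT x|\<nu>. tail_bump (real n) x) < d"
      using order_tendstoD(2)[OF integral_tail_bump_tendsto[OF \<mu>] \<open>d > 0\<close>]
        order_tendstoD(2)[OF integral_tail_bump_tendsto[OF \<nu>] \<open>d > 0\<close>]
      by (rule eventually_conj)
    then obtain n :: nat where n: "(LINT x|\<mu>. tail_bump (real n) x) < d" "(LINT x|\<nu>. tail_bump (real n) x) < d"
      using eventually_happens'[OF sequentially_bot] by blast
    define R where "R = real n"
    have "R \<ge> 0" by (simp add: R_def)
    obtain p where p: "sum_of_products p" "\<And>z. z \<in> cbox (- R, - R) (R, R) \<Longrightarrow> \<bar>F z - p z\<bar> < d"
      using sum_of_products_dense[OF compact_cbox continuous_on_subset[OF F(1) subset_UNIV] \<open>d > 0\<close>] by blast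
    \<comment> \<open>Outside the box the error is at most \<open>d + 2 * B\<close>, and there the tail function \<open>T R\<close> is at least \<open>1\<close>.\<close>
    have pointwise: "\<bar>F z - p (clip R z)\<bar> \<le> d + 2 * B * T R z" for z
    proof (cases "z \<in> cbox (- R, - R) (R, R)")
      case True
      then have "clip R z = z"
        by (cases z) (auto simp: clip_def truncation_def cbox_Pair_eq)
      then show ?thesis
        using p(2)[OF True] T_nonneg[of R z] \<open>B \<ge> 0\<close> by (simp add: add_increasing2 less_imp_le)
    next
      case False
      then have "R < \<bar>fst z\<bar> \<or> R < \<bar>snd z\<bar>"
        by (cases z) (auto simp: cbox_Pair_eq)
      then have "1 \<le> T R z"
        using tail_bump_bounds by (auto simp: T_def tail_bump_def)
      then have "2 * B * 1 \<le> 2 * B * T R z"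
        using \<open>B \<ge> 0\<close> by (intro mult_left_mono) auto
      moreover have "\<bar>F z - F (clip R z)\<bar> \<le> 2 * B"
        using B[of z] B[of "clip R z"] by linarith
      moreover have "\<bar>F (clip R z) - p (clip R z)\<bar> < d"
        using p(2) clip_box[OF \<open>R \<ge> 0\<close>] by blast
      ultimately show ?thesis by linarith
    qed
    have close: "\<bar>integral\<^sup>L N F - (LINT z|N. p (clip R z))\<bar> \<le> d + 2 * B * integral\<^sup>L N (T R)"
      if N: "prob_space N" "sets N = sets borel" for N
    proof -
      interpret N: prob_space N by (rule N)
      have F_int: "integrable N F"
        using bdd_integrable[OF N F(1) B] .
      have p_int: "integrable N (\<lambda>z. p (clip R z))"
        using sum_of_products_continuous[OF p(1)] \<open>R \<ge> 0\<close> by (rule clip_integrable[OF N])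
      have "\<bar>integral\<^sup>L N F - (LINT z|N. p (clip R z))\<bar> = \<bar>LINT z|N. F z - p (clip R z)\<bar>"
        using F_int p_int by simp
      also have "\<dots> \<le> (LINT z|N. \<bar>F z - p (clip R z)\<bar>)"
        by (rule integral_abs_bound)
      also have "\<dots> \<le> (LINT z|N. d + 2 * B * T R z)"
        using F_int p_int T_integrable[OF N] by (intro integral_mono pointwise) auto
      also have "\<dots> = d + 2 * B * integral\<^sup>L N (T R)"
        using T_integrable[OF N] by (simp add: N.prob_space)
      finally show ?thesis .
    qed
    have T_small: "integral\<^sup>L ?Q (T R) < 2 * d"
      using n by (simp add: T_Q R_def)
    have "\<forall>\<^sub>F k in sequentially. integral\<^sup>L (P k) (T R) < 3 * d"
      using T_small \<open>d > 0\<close> by (intro order_tendstoD(2)[OF T_lim]) simp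
    moreover have "\<forall>\<^sub>F k in sequentially. dist (LINT z|P k. p (clip R z)) (LINT z|?Q. p (clip R z)) < d"
      using clipped_lim[OF p(1) \<open>R \<ge> 0\<close>] \<open>d > 0\<close> by (rule tendstoD)
    ultimately show "\<forall>\<^sub>F k in sequentially. dist (integral\<^sup>L (P k) F) (integral\<^sup>L ?Q F) < e"
    proof eventually_elim
      case (elim k)
      have "2 * B * integral\<^sup>L (P k) (T R) \<le> 2 * B * (3 * d)" "2 * B * integral\<^sup>L ?Q (T R) \<le> 2 * B * (2 * d)"
        using elim(1) T_small \<open>B \<ge> 0\<close> by (intro mult_left_mono; simp)+
      then have "dist (integral\<^sup>L (P k) F) (integral\<^sup>L ?Q F) < 4 * d + 10 * (B * d)"
        using close[OF P P_sets, of k] close[OF prod.prob_space_axioms Q_sets] elim(2) \<open>d > 0\<close>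
        unfolding dist_real_def by linarith
      also have "\<dots> = d * (4 + 10 * B)" by (simp add: algebra_simps)
      also have "\<dots> = e" using \<open>B \<ge> 0\<close> by (simp add: d_def)
      finally show ?case .
    qed
  qed
qed

section \<open>Normal approximation of a sum of independent variables\<close>

lemma exp_minus_quadratic_bound:
  fixes x :: real
  assumes "0 \<le> x"
  shows "\<bar>exp (- x) - (1 - x)\<bar> \<le> x\<^sup>2"
proof -
  have "1 \<le> (1 + x) * (1 - x + x\<^sup>2)"
    using assms by (simp add: algebra_simps power2_eq_square)
  also have "\<dots> \<le> exp x * (1 - x + x\<^sup>2)"
  proof (rule mult_right_mono)
    have "1 - x + x\<^sup>2 = (1 - x / 2)\<^sup>2 + 3 / 4 * x\<^sup>2"
      by (simp add: power2_eq_square field_simps)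
    then show "0 \<le> 1 - x + x\<^sup>2" by simp
  qed (simp add: exp_ge_add_one_self)
  finally have "exp (- x) \<le> 1 - x + x\<^sup>2"
    by (simp add: exp_minus field_simps)
  then show ?thesis
    using exp_ge_add_one_self[of "- x"] by simp
qed

text \<open>
  Up to a constant factor a bound for the error of the second-order Taylor expansion of \<open>iexp x\<close>: cubic
  near \<open>0\<close>, quadratic at infinity, so that it is integrable as soon as second moments exist.
\<close>

definition capped_cube :: "real \<Rightarrow> real" where
  "capped_cube x = min (x\<^sup>2) (\<bar>x\<bar> ^ 3)"

lemma capped_cube_nonneg: "0 \<le> capped_cube x"
  and capped_cube_le_square: "capped_cube x \<le> x\<^sup>2"
  by (auto simp: capped_cube_def)

lemma capped_cube_measurable [measurable]: "capped_cube \<in> borel_measurable borel"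
  unfolding capped_cube_def by measurable

lemma capped_cube_mono:
  assumes "\<bar>x\<bar> \<le> \<bar>y\<bar>"
  shows "capped_cube x \<le> capped_cube y"
  using power_mono[OF assms, of 2] power_mono[OF assms, of 3]
  unfolding capped_cube_def power2_abs by (intro min.mono) auto

text \<open>
  Subadditivity up to a constant splits the error of a pair into one term for each coordinate, and
  each coordinate is identically distributed along the sequence, while the pairs may vary in law.
\<close>

lemma capped_cube_add: "capped_cube (x + y) \<le> 8 * (capped_cube x + capped_cube y)"
proof -
  have double: "capped_cube (2 * z) \<le> 8 * capped_cube z" for z
  proof -
    have "min (4 * p) (8 * q) \<le> 8 * min p q" if "0 \<le> p" for p q :: real
      using that by (auto simp: min_def)
    from this[of "z\<^sup>2" "\<bar>z\<bar> ^ 3"] show ?thesis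
      unfolding capped_cube_def by (simp add: power_mult_distrib abs_mult)
  qed
  \<comment> \<open>The larger summand in absolute value, so that \<open>\<bar>x + y\<bar> \<le> \<bar>2 * z\<bar>\<close>.\<close>
  define z where "z = (if \<bar>x\<bar> \<le> \<bar>y\<bar> then y else x)"
  have "capped_cube (x + y) \<le> capped_cube (2 * z)"
    by (rule capped_cube_mono) (auto simp: z_def)
  also have "\<dots> \<le> 8 * capped_cube z" by (rule double)
  also have "\<dots> \<le> 8 * (capped_cube x + capped_cube y)"
    using capped_cube_nonneg[of x] capped_cube_nonneg[of y] by (auto simp: z_def)
  finally show ?thesis .
qed

lemma capped_cube_scale:
  assumes "\<bar>a\<bar> \<le> d"
  shows "capped_cube (a * x) \<le> a\<^sup>2 * (x\<^sup>2 * min 1 (d * \<bar>x\<bar>))"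
proof -
  have "capped_cube (a * x) = a\<^sup>2 * x\<^sup>2 * min 1 (\<bar>a\<bar> * \<bar>x\<bar>)"
  proof -
    have "\<bar>a * x\<bar> ^ 3 = (a\<^sup>2 * x\<^sup>2) * (\<bar>a\<bar> * \<bar>x\<bar>)"
      by (simp add: abs_mult power_mult_distrib power3_eq_cube power2_eq_square) 
        (metis abs_mult abs_mult_self_eq mult.assoc mult.left_commute)
    then show ?thesis
      unfolding capped_cube_def power_mult_distrib using min_mult_distrib_left[of "a\<^sup>2 * x\<^sup>2" 1 "\<bar>a\<bar> * \<bar>x\<bar>"]
      by simp
  qed
  also have "\<dots> \<le> a\<^sup>2 * x\<^sup>2 * min 1 (d * \<bar>x\<bar>)"
    using assms by (intro mult_left_mono min.mono mult_right_mono) auto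
  finally show ?thesis by (simp add: mult.assoc)
qed

text \<open>
  Lindeberg's replacement: characteristic function and Gaussian exponential are both products of
  factors of norm at most \<open>1\<close>, so their distance is at most the sum of the distances of the factors, and
  each factor agrees with \<open>1 - v/2\<close> to second order, where \<open>v\<close> is the variance of its summand.
\<close>

lemma (in prob_space) char_independent_sum_gaussian_bound:
  fixes X :: "'i \<Rightarrow> 'a \<Rightarrow> real"
  assumes indep: "indep_vars (\<lambda>_. borel) X I"
    and X_int: "\<And>i. i \<in> I \<Longrightarrow> integrable M (X i)"
    and sq_int: "\<And>i. i \<in> I \<Longrightarrow> integrable M (\<lambda>\<omega>. (X i \<omega>)\<^sup>2)"
    and mean: "\<And>i. i \<in> I \<Longrightarrow> expectation (X i) = 0"
  shows "cmod ((CLINT \<omega>|M. iexp (\<Sum>i\<in>I. X i \<omega>)) - exp (- (\<Sum>i\<in>I. expectation (\<lambda>\<omega>. (X i \<omega>)\<^sup>2)) / 2))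
    \<le> (\<Sum>i\<in>I. expectation (\<lambda>\<omega>. capped_cube (X i \<omega>)) + (expectation (\<lambda>\<omega>. (X i \<omega>)\<^sup>2))\<^sup>2)"
proof (cases "finite I")
  case True
  define v where "v i = expectation (\<lambda>\<omega>. (X i \<omega>)\<^sup>2)" for i
  have v_nonneg: "0 \<le> v i" for i
    unfolding v_def by simp
  have rv: "random_variable borel (X i)" if "i \<in> I" for i
    using X_int[OF that] by auto
  have "random_variable borel (\<lambda>\<omega>. \<Sum>i\<in>I. X i \<omega>)"
    using rv by (rule borel_measurable_sum)
  then have "(CLINT \<omega>|M. iexp (\<Sum>i\<in>I. X i \<omega>)) = char (distr M borel (\<lambda>\<omega>. \<Sum>i\<in>I. X i \<omega>)) 1"
    by (simp add: char_def integral_distr)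
  also have "\<dots> = (\<Prod>i\<in>I. char (distr M borel (X i)) 1)"
    using indep by (rule char_distr_sum)
  finally have char: "(CLINT \<omega>|M. iexp (\<Sum>i\<in>I. X i \<omega>)) = (\<Prod>i\<in>I. char (distr M borel (X i)) 1)" .
  have gauss: "complex_of_real (exp (- (\<Sum>i\<in>I. v i) / 2)) = (\<Prod>i\<in>I. complex_of_real (exp (- v i / 2)))"
    using True by (simp add: exp_sum[symmetric] sum_negf sum_divide_distrib flip: of_real_prod)
  have term_bound: "cmod (char (distr M borel (X i)) 1 - exp (- v i / 2)) \<le> expectation (\<lambda>\<omega>. capped_cube (X i \<omega>)) + (v i)\<^sup>2"
    if i: "i \<in> I" for i
  proof -
    note [measurable] = rv[OF i]
    have cap_int: "integrable M (\<lambda>\<omega>. capped_cube (X i \<omega>))"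
      by (rule Bochner_Integration.integrable_bound[OF sq_int[OF i]])
         (auto simp: capped_cube_nonneg capped_cube_le_square)
    have min_int: "integrable M (\<lambda>\<omega>. min (6 * (X i \<omega>)\<^sup>2) (\<bar>X i \<omega>\<bar> ^ 3))"
      by (rule Bochner_Integration.integrable_bound[OF integrable_mult_right[OF sq_int[OF i], of 6]]) auto
    have "cmod (char (distr M borel (X i)) 1 - (1 - v i / 2)) \<le> 1 / 6 * expectation (\<lambda>\<omega>. min (6 * (X i \<omega>)\<^sup>2) (\<bar>X i \<omega>\<bar> ^ 3))"
      using char_approx3'[OF rv[OF i] X_int[OF i] sq_int[OF i] mean[OF i] refl refl, of 1]
      by (simp add: v_def mean[OF i])
    also have "\<dots> \<le> 1 / 6 * expectation (\<lambda>\<omega>. 6 * capped_cube (X i \<omega>))"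
    proof (intro mult_left_mono integral_mono)
      have "min (6 * a) b \<le> 6 * min a b" if "0 \<le> a" "0 \<le> b" for a b :: real
        using that by (auto simp: min_def)
      then show "min (6 * (X i \<omega>)\<^sup>2) (\<bar>X i \<omega>\<bar> ^ 3) \<le> 6 * capped_cube (X i \<omega>)" for \<omega>
        by (simp add: capped_cube_def)
    qed (use min_int cap_int in auto)
    also have "\<dots> = expectation (\<lambda>\<omega>. capped_cube (X i \<omega>))"
      by simp
    finally have 1: "cmod (char (distr M borel (X i)) 1 - (1 - v i / 2)) \<le> expectation (\<lambda>\<omega>. capped_cube (X i \<omega>))" .
    have "cmod ((1 - v i / 2) - exp (- v i / 2)) = \<bar>exp (- (v i / 2)) - (1 - v i / 2)\<bar>"
      unfolding norm_of_real by (simp add: abs_minus_commute)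
    also have "\<dots> \<le> (v i / 2)\<^sup>2"
      using v_nonneg by (intro exp_minus_quadratic_bound) simp
    also have "\<dots> \<le> (v i)\<^sup>2"
      by (simp add: power_divide)
    finally show ?thesis
      using 1 norm_triangle_ineq[of "char (distr M borel (X i)) 1 - (1 - v i / 2)" "(1 - v i / 2) - exp (- v i / 2)"]
      by simp
  qed
  have "cmod ((CLINT \<omega>|M. iexp (\<Sum>i\<in>I. X i \<omega>)) - exp (- (\<Sum>i\<in>I. v i) / 2))
     = cmod ((\<Prod>i\<in>I. char (distr M borel (X i)) 1) - (\<Prod>i\<in>I. complex_of_real (exp (- v i / 2))))"
    by (simp only: char gauss)
  also have "\<dots> \<le> (\<Sum>i\<in>I. cmod (char (distr M borel (X i)) 1 - exp (- v i / 2)))"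
  proof (rule norm_prod_diff)
    show "cmod (char (distr M borel (X i)) 1) \<le> 1" if "i \<in> I" for i
      using rv[OF that] by (intro real_distribution.cmod_char_le_1) simp
    show "cmod (complex_of_real (exp (- v i / 2))) \<le> 1" for i
      using v_nonneg[of i] by simp
  qed
  also have "\<dots> \<le> (\<Sum>i\<in>I. expectation (\<lambda>\<omega>. capped_cube (X i \<omega>)) + (v i)\<^sup>2)"
    by (intro sum_mono term_bound)
  finally show ?thesis by (simp add: v_def)
qed (simp add: prob_space)

section \<open>Partial sums of two standardized sequences\<close>

lemma sum_initial_segment:
  fixes f :: "nat \<Rightarrow> real"
  assumes "n \<le> N"
  shows "(\<Sum>j=1..N. if j \<le> n then f j else 0) = (\<Sum>j=1..n. f j)"
  using assms by (intro sum.mono_neutral_cong_right) auto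

locale independent_standardized_pairs = prob_space M for M :: "'a measure" +
  fixes U V :: "nat \<Rightarrow> 'a \<Rightarrow> real"
  assumes indep: "indep_vars (\<lambda>_. borel) (\<lambda>j \<omega>. (U j \<omega>, V j \<omega>)) {1..}"
    and distr_U: "\<And>j. j \<ge> 1 \<Longrightarrow> distr M borel (U j) = distr M borel (U 1)"
    and distr_V: "\<And>j. j \<ge> 1 \<Longrightarrow> distr M borel (V j) = distr M borel (V 1)"
    and square_integrable: "\<And>j. j \<ge> 1 \<Longrightarrow> integrable M (\<lambda>\<omega>. (U j \<omega>)\<^sup>2)" "\<And>j. j \<ge> 1 \<Longrightarrow> integrable M (\<lambda>\<omega>. (V j \<omega>)\<^sup>2)"
    and centred: "\<And>j. j \<ge> 1 \<Longrightarrow> expectation (U j) = 0" "\<And>j. j \<ge> 1 \<Longrightarrow> expectation (V j) = 0"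
    and unit_variance: "\<And>j. j \<ge> 1 \<Longrightarrow> expectation (\<lambda>\<omega>. (U j \<omega>)\<^sup>2) = 1" "\<And>j. j \<ge> 1 \<Longrightarrow> expectation (\<lambda>\<omega>. (V j \<omega>)\<^sup>2) = 1"
begin

definition normalized_sum :: "(nat \<Rightarrow> 'a \<Rightarrow> real) \<Rightarrow> nat \<Rightarrow> 'a \<Rightarrow> real" where
  "normalized_sum X n \<omega> = (\<Sum>j=1..n. X j \<omega>) / sqrt (real n)"

definition sum_correlation :: "nat \<Rightarrow> nat \<Rightarrow> real" where
  "sum_correlation n m = (\<Sum>j=1..min n m. expectation (\<lambda>\<omega>. U j \<omega> * V j \<omega>)) / sqrt (real n * real m)"

text \<open>
  A truncated second moment that bounds the Lindeberg terms: a summand \<open>a * X j\<close> with \<open>\<bar>a\<bar> \<le> d\<close>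
  contributes at most \<open>a\<^sup>2\<close> times this quantity. Using \<open>X 1\<close> for all indices relies on \<open>X\<close> being
  identically distributed.
\<close>

definition lindeberg :: "(nat \<Rightarrow> 'a \<Rightarrow> real) \<Rightarrow> real \<Rightarrow> real" where
  "lindeberg X d = expectation (\<lambda>\<omega>. (X 1 \<omega>)\<^sup>2 * min 1 (d * \<bar>X 1 \<omega>\<bar>))"

lemma measurable_pair_components:
  assumes "j \<ge> 1"
  shows measurable_U: "U j \<in> borel_measurable M" and measurable_V: "V j \<in> borel_measurable M"
proof -
  have "(\<lambda>\<omega>. (U j \<omega>, V j \<omega>)) \<in> measurable M (borel \<Otimes>\<^sub>M borel)"
    using indep assms unfolding indep_vars_def2 borel_prod by simp
  from measurable_compose[OF this measurable_fst] measurable_compose[OF this measurable_snd]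
  show "U j \<in> borel_measurable M" "V j \<in> borel_measurable M" by simp_all
qed

lemma integrable_component:
  assumes "j \<ge> 1"
  shows "integrable M (U j)" "integrable M (V j)"
  using square_integrable[OF assms] measurable_pair_components[OF assms]
  by (auto intro: square_integrable_imp_integrable)

lemma integrable_product_UV:
  assumes "j \<ge> 1"
  shows "integrable M (\<lambda>\<omega>. U j \<omega> * V j \<omega>)"
proof (rule Bochner_Integration.integrable_bound)
  show "integrable M (\<lambda>\<omega>. (U j \<omega>)\<^sup>2 + (V j \<omega>)\<^sup>2)"
    using square_integrable[OF assms] by simp
  show "AE \<omega> in M. norm (U j \<omega> * V j \<omega>) \<le> norm ((U j \<omega>)\<^sup>2 + (V j \<omega>)\<^sup>2)"
  proof (rule AE_I2)
    fix \<omega>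
    have "0 \<le> (\<bar>U j \<omega>\<bar> - \<bar>V j \<omega>\<bar>)\<^sup>2 + \<bar>U j \<omega>\<bar>\<^sup>2 + \<bar>V j \<omega>\<bar>\<^sup>2" by simp
    then show "norm (U j \<omega> * V j \<omega>) \<le> norm ((U j \<omega>)\<^sup>2 + (V j \<omega>)\<^sup>2)"
      by (simp add: power2_eq_square algebra_simps abs_mult)
  qed
qed (use measurable_pair_components[OF assms] in measurable)

lemma lindeberg_tendsto_0:
  assumes X: "X 1 \<in> borel_measurable M" "integrable M (\<lambda>\<omega>. (X 1 \<omega>)\<^sup>2)"
    and d: "d \<longlonglongrightarrow> 0" "\<And>n. 0 \<le> d n"
  shows "(\<lambda>n. lindeberg X (d n)) \<longlonglongrightarrow> 0"
proof -
  note [measurable] = X(1)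
  have "(\<lambda>n. lindeberg X (d n)) \<longlonglongrightarrow> expectation (\<lambda>\<omega>. 0)"
    unfolding lindeberg_def
  proof (rule integral_dominated_convergence[where w="\<lambda>\<omega>. (X 1 \<omega>)\<^sup>2"])
    show "AE \<omega> in M. (\<lambda>n. (X 1 \<omega>)\<^sup>2 * min 1 (d n * \<bar>X 1 \<omega>\<bar>)) \<longlonglongrightarrow> 0"
    proof (rule AE_I2)
      fix \<omega>
      have "(\<lambda>n. (X 1 \<omega>)\<^sup>2 * min 1 (d n * \<bar>X 1 \<omega>\<bar>)) \<longlonglongrightarrow> (X 1 \<omega>)\<^sup>2 * min 1 (0 * \<bar>X 1 \<omega>\<bar>)"
        by (intro tendsto_intros d)
      then show "(\<lambda>n. (X 1 \<omega>)\<^sup>2 * min 1 (d n * \<bar>X 1 \<omega>\<bar>)) \<longlonglongrightarrow> 0" by simp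
    qed
    show "AE \<omega> in M. norm ((X 1 \<omega>)\<^sup>2 * min 1 (d n * \<bar>X 1 \<omega>\<bar>)) \<le> (X 1 \<omega>)\<^sup>2" for n
      using d(2)[of n] by (auto simp: abs_mult intro!: AE_I2 mult_left_le)
  qed (use X in auto)
  then show ?thesis by simp
qed

lemma lindeberg_nonneg: "0 \<le> d \<Longrightarrow> 0 \<le> lindeberg X d"
  unfolding lindeberg_def by (intro integral_nonneg_AE AE_I2) auto

lemma expectation_capped_cube_le:
  assumes X: "integrable M (\<lambda>\<omega>. (X j \<omega>)\<^sup>2)" "X j \<in> borel_measurable M" "X 1 \<in> borel_measurable M"
    and distr: "distr M borel (X j) = distr M borel (X 1)" and "\<bar>a\<bar> \<le> d"
  shows "expectation (\<lambda>\<omega>. capped_cube (a * X j \<omega>)) \<le> a\<^sup>2 * lindeberg X d"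
proof -
  note [measurable] = X(2,3)
  have int: "integrable M (\<lambda>\<omega>. (X j \<omega>)\<^sup>2 * min 1 (d * \<bar>X j \<omega>\<bar>))"
    using assms(5)
    by (intro Bochner_Integration.integrable_bound[OF X(1)]) (auto simp: abs_mult intro!: AE_I2 mult_left_le)
  have "expectation (\<lambda>\<omega>. capped_cube (a * X j \<omega>)) \<le> expectation (\<lambda>\<omega>. a\<^sup>2 * ((X j \<omega>)\<^sup>2 * min 1 (d * \<bar>X j \<omega>\<bar>)))"
  proof (rule integral_mono)
    show "integrable M (\<lambda>\<omega>. capped_cube (a * X j \<omega>))"
      using X(1) by (intro Bochner_Integration.integrable_bound[OF integrable_mult_right[OF X(1), of "a\<^sup>2"]])
        (auto simp: capped_cube_nonneg intro!: AE_I2 order_trans[OF capped_cube_le_square] simp: power_mult_distrib)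
  qed (use int capped_cube_scale[OF assms(5)] in auto)
  also have "\<dots> = a\<^sup>2 * (LINT x|distr M borel (X j). x\<^sup>2 * min 1 (d * \<bar>x\<bar>))"
    by (subst integral_distr) auto
  also have "(LINT x|distr M borel (X j). x\<^sup>2 * min 1 (d * \<bar>x\<bar>)) = lindeberg X d"
    unfolding distr lindeberg_def by (subst integral_distr) (auto simp del: One_nat_def)
  finally show ?thesis .
qed


lemma expectation_square_linear:
  assumes "j \<ge> 1"
  shows "integrable M (\<lambda>\<omega>. (a * U j \<omega> + b * V j \<omega>)\<^sup>2)"
    and "expectation (\<lambda>\<omega>. (a * U j \<omega> + b * V j \<omega>)\<^sup>2) = a\<^sup>2 + b\<^sup>2 + 2 * a * b * expectation (\<lambda>\<omega>. U j \<omega> * V j \<omega>)"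
    and "expectation (\<lambda>\<omega>. (a * U j \<omega> + b * V j \<omega>)\<^sup>2) \<le> 2 * a\<^sup>2 + 2 * b\<^sup>2"
proof -
  have expand: "(\<lambda>\<omega>. (a * U j \<omega> + b * V j \<omega>)\<^sup>2) = (\<lambda>\<omega>. a\<^sup>2 * (U j \<omega>)\<^sup>2 + (b\<^sup>2 * (V j \<omega>)\<^sup>2 + (2 * a * b) * (U j \<omega> * V j \<omega>)))"
    by (auto simp: power2_eq_square algebra_simps)
  note int = square_integrable[OF assms] integrable_product_UV[OF assms]
  show sq: "integrable M (\<lambda>\<omega>. (a * U j \<omega> + b * V j \<omega>)\<^sup>2)"
    unfolding expand by (intro Bochner_Integration.integrable_add integrable_mult_right int)
  show "expectation (\<lambda>\<omega>. (a * U j \<omega> + b * V j \<omega>)\<^sup>2) = a\<^sup>2 + b\<^sup>2 + 2 * a * b * expectation (\<lambda>\<omega>. U j \<omega> * V j \<omega>)"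
    unfolding expand using int unit_variance[OF assms]
    by (subst Bochner_Integration.integral_add, simp, simp)+ simp
  have "expectation (\<lambda>\<omega>. (a * U j \<omega> + b * V j \<omega>)\<^sup>2) \<le> expectation (\<lambda>\<omega>. 2 * a\<^sup>2 * (U j \<omega>)\<^sup>2 + 2 * b\<^sup>2 * (V j \<omega>)\<^sup>2)"
  proof (rule integral_mono[OF sq])
    fix \<omega>
    have "0 \<le> (a * U j \<omega> - b * V j \<omega>)\<^sup>2" by simp
    then show "(a * U j \<omega> + b * V j \<omega>)\<^sup>2 \<le> 2 * a\<^sup>2 * (U j \<omega>)\<^sup>2 + 2 * b\<^sup>2 * (V j \<omega>)\<^sup>2"
      by (simp add: power2_eq_square algebra_simps)
  qed (use int in simp)
  also have "\<dots> = 2 * a\<^sup>2 + 2 * b\<^sup>2"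
    using int unit_variance[OF assms] by (subst Bochner_Integration.integral_add) simp_all
  finally show "expectation (\<lambda>\<omega>. (a * U j \<omega> + b * V j \<omega>)\<^sup>2) \<le> 2 * a\<^sup>2 + 2 * b\<^sup>2" .
qed

text \<open>
  Pad the shorter sequence with zero coefficients, so that \<open>s * Y1 + t * Y2\<close> becomes a single sum of
  independent variables \<open>a j * U j + b j * V j\<close> over \<open>j \<le> max n m\<close>. Only the indices up to
  \<open>min n m\<close> contribute a covariance, which produces the correlation term in the exponent. The bound depends
  on \<open>s\<close> and \<open>t\<close> only through \<open>K\<close>.
\<close>

lemma joint_characteristic_function_bound:
  assumes n: "n \<ge> 1" and m: "m \<ge> 1" and s: "\<bar>s\<bar> \<le> K" and t: "\<bar>t\<bar> \<le> K"
  shows "cmod ((CLINT \<omega>|M. iexp (s * normalized_sum U n \<omega> + t * normalized_sum V m \<omega>))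
      - exp (- (s\<^sup>2 + t\<^sup>2 + 2 * s * t * sum_correlation n m) / 2))
    \<le> 8 * K\<^sup>2 * (lindeberg U (K / sqrt n) + lindeberg V (K / sqrt m)) + 8 * K ^ 4 * (1 / n + 1 / m)"
proof -
  define a where "a j = (if j \<le> n then s / sqrt n else 0)" for j
  define b where "b j = (if j \<le> m then t / sqrt m else 0)" for j
  define I where "I = {1..max n m}"
  define X where "X j \<omega> = a j * U j \<omega> + b j * V j \<omega>" for j \<omega>
  have I: "j \<ge> 1" if "j \<in> I" for j
    using that by (simp add: I_def)
  have "K \<ge> 0" using s by linarith
  have abs_a: "\<bar>a j\<bar> \<le> K / sqrt n" and abs_b: "\<bar>b j\<bar> \<le> K / sqrt m" for j
    using s t \<open>K \<ge> 0\<close> by (auto simp: a_def b_def intro!: divide_right_mono)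
  have sq_a: "(a j)\<^sup>2 = (if j \<le> n then s\<^sup>2 / n else 0)" and sq_b: "(b j)\<^sup>2 = (if j \<le> m then t\<^sup>2 / m else 0)" for j
    by (auto simp: a_def b_def power_divide)
  have sum_a: "(\<Sum>j\<in>I. (a j)\<^sup>2) = s\<^sup>2" and sum_b: "(\<Sum>j\<in>I. (b j)\<^sup>2) = t\<^sup>2"
    unfolding sq_a sq_b I_def using n m by (simp_all add: sum_initial_segment del: One_nat_def)
  have sum_X: "(\<Sum>j\<in>I. X j \<omega>) = s * normalized_sum U n \<omega> + t * normalized_sum V m \<omega>" for \<omega>
  proof -
    have "(\<Sum>j\<in>I. X j \<omega>) = (\<Sum>j=1..max n m. if j \<le> n then s / sqrt n * U j \<omega> else 0)
        + (\<Sum>j=1..max n m. if j \<le> m then t / sqrt m * V j \<omega> else 0)"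
      unfolding X_def I_def sum.distrib by (intro arg_cong2[where f="(+)"] sum.cong) (auto simp: a_def b_def)
    also have "\<dots> = (\<Sum>j=1..n. s / sqrt n * U j \<omega>) + (\<Sum>j=1..m. t / sqrt m * V j \<omega>)"
      by (simp only: sum_initial_segment max.cobounded1 max.cobounded2)
    finally show ?thesis
      by (simp add: normalized_sum_def sum_distrib_left sum_divide_distrib)
  qed
  have sum_v: "(\<Sum>j\<in>I. expectation (\<lambda>\<omega>. (X j \<omega>)\<^sup>2)) = s\<^sup>2 + t\<^sup>2 + 2 * s * t * sum_correlation n m"
  proof -
    have ab: "2 * a j * b j * r = (if j \<le> min n m then 2 * s * t / sqrt (real n * real m) * r else 0)" for j r
      by (auto simp: a_def b_def real_sqrt_mult)
    have "(\<Sum>j\<in>I. expectation (\<lambda>\<omega>. (X j \<omega>)\<^sup>2))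
        = (\<Sum>j\<in>I. (a j)\<^sup>2 + (b j)\<^sup>2 + 2 * a j * b j * expectation (\<lambda>\<omega>. U j \<omega> * V j \<omega>))"
      unfolding X_def using I by (intro sum.cong refl expectation_square_linear(2))
    also have "\<dots> = s\<^sup>2 + t\<^sup>2 + (\<Sum>j\<in>I. 2 * a j * b j * expectation (\<lambda>\<omega>. U j \<omega> * V j \<omega>))"
      by (simp add: sum.distrib sum_a sum_b)
    also have "(\<Sum>j\<in>I. 2 * a j * b j * expectation (\<lambda>\<omega>. U j \<omega> * V j \<omega>))
        = (\<Sum>j=1..min n m. 2 * s * t / sqrt (real n * real m) * expectation (\<lambda>\<omega>. U j \<omega> * V j \<omega>))"
      unfolding ab I_def by (rule sum_initial_segment) simp
    also have "\<dots> = 2 * s * t * sum_correlation n m"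
      by (simp add: sum_correlation_def sum_distrib_left sum_divide_distrib)
    finally show ?thesis .
  qed
  have X_indep: "indep_vars (\<lambda>_. borel) X I"
  proof -
    have "indep_vars (\<lambda>_. borel) (\<lambda>j \<omega>. (\<lambda>z. a j * fst z + b j * snd z) (U j \<omega>, V j \<omega>)) I"
    proof (rule indep_vars_compose2[where Y="\<lambda>j z. a j * fst z + b j * snd z"])
      show "indep_vars (\<lambda>_. borel) (\<lambda>j \<omega>. (U j \<omega>, V j \<omega>)) I"
        using I by (intro indep_vars_subset[OF indep]) auto
      show "(\<lambda>z. a j * fst z + b j * snd z) \<in> borel_measurable borel" for j
        by (intro borel_measurable_continuous_onI continuous_intros)
    qed
    then show ?thesis by (simp add: X_def[abs_def])
  qed
  have cap: "expectation (\<lambda>\<omega>. capped_cube (X j \<omega>))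
      \<le> 8 * ((a j)\<^sup>2 * lindeberg U (K / sqrt n) + (b j)\<^sup>2 * lindeberg V (K / sqrt m))" if "j \<in> I" for j
  proof -
    note j = I[OF that]
    note [measurable] = measurable_pair_components[OF j]
    have int: "integrable M (\<lambda>\<omega>. capped_cube (f \<omega>))"
      if "integrable M (\<lambda>\<omega>. (f \<omega>)\<^sup>2)" and [measurable]: "f \<in> borel_measurable M" for f
      by (rule Bochner_Integration.integrable_bound[OF that(1)])
         (auto simp: capped_cube_nonneg capped_cube_le_square)
    have ints: "integrable M (\<lambda>\<omega>. capped_cube (a j * U j \<omega>))" "integrable M (\<lambda>\<omega>. capped_cube (b j * V j \<omega>))"
        "integrable M (\<lambda>\<omega>. capped_cube (X j \<omega>))"
      using square_integrable[OF j] expectation_square_linear(1)[OF j, of "a j" "b j"]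
      by (auto intro!: int simp: power_mult_distrib X_def[abs_def])
    have "expectation (\<lambda>\<omega>. capped_cube (X j \<omega>)) \<le> expectation (\<lambda>\<omega>. 8 * (capped_cube (a j * U j \<omega>) + capped_cube (b j * V j \<omega>)))"
    proof (rule integral_mono)
      show "capped_cube (X j \<omega>) \<le> 8 * (capped_cube (a j * U j \<omega>) + capped_cube (b j * V j \<omega>))" for \<omega>
        unfolding X_def by (rule capped_cube_add)
    qed (use ints in simp_all)
    also have "\<dots> = 8 * (expectation (\<lambda>\<omega>. capped_cube (a j * U j \<omega>)) + expectation (\<lambda>\<omega>. capped_cube (b j * V j \<omega>)))"
      using ints by simp
    also have "\<dots> \<le> 8 * ((a j)\<^sup>2 * lindeberg U (K / sqrt n) + (b j)\<^sup>2 * lindeberg V (K / sqrt m))"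
      by (intro mult_left_mono add_mono expectation_capped_cube_le abs_a abs_b
          square_integrable measurable_pair_components distr_U distr_V j) auto
    finally show ?thesis .
  qed
  have sq: "(expectation (\<lambda>\<omega>. (X j \<omega>)\<^sup>2))\<^sup>2 \<le> 2 * K\<^sup>2 * (1 / n + 1 / m) * (2 * (a j)\<^sup>2 + 2 * (b j)\<^sup>2)" if "j \<in> I" for j
  proof -
    have v: "expectation (\<lambda>\<omega>. (X j \<omega>)\<^sup>2) \<le> 2 * (a j)\<^sup>2 + 2 * (b j)\<^sup>2"
      unfolding X_def by (rule expectation_square_linear(3)[OF I[OF that]])
    have "(a j)\<^sup>2 \<le> (K / sqrt n)\<^sup>2" "(b j)\<^sup>2 \<le> (K / sqrt m)\<^sup>2"
      using abs_a[of j] abs_b[of j] \<open>K \<ge> 0\<close> by (simp_all add: abs_le_square_iff[symmetric])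
    then have "2 * (a j)\<^sup>2 + 2 * (b j)\<^sup>2 \<le> 2 * K\<^sup>2 * (1 / n + 1 / m)"
      by (simp add: power_divide algebra_simps)
    with v have "expectation (\<lambda>\<omega>. (X j \<omega>)\<^sup>2) * expectation (\<lambda>\<omega>. (X j \<omega>)\<^sup>2)
        \<le> (2 * K\<^sup>2 * (1 / n + 1 / m)) * (2 * (a j)\<^sup>2 + 2 * (b j)\<^sup>2)"
      by (intro mult_mono) auto
    then show ?thesis by (simp add: power2_eq_square)
  qed
  have st: "s\<^sup>2 \<le> K\<^sup>2" "t\<^sup>2 \<le> K\<^sup>2"
    using s t \<open>K \<ge> 0\<close> by (simp_all add: abs_le_square_iff[symmetric])
  have lin: "0 \<le> lindeberg U (K / sqrt n)" "0 \<le> lindeberg V (K / sqrt m)"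
    using \<open>K \<ge> 0\<close> by (auto intro!: lindeberg_nonneg)
  have "cmod ((CLINT \<omega>|M. iexp (\<Sum>j\<in>I. X j \<omega>)) - exp (- (\<Sum>j\<in>I. expectation (\<lambda>\<omega>. (X j \<omega>)\<^sup>2)) / 2))
      \<le> (\<Sum>j\<in>I. expectation (\<lambda>\<omega>. capped_cube (X j \<omega>)) + (expectation (\<lambda>\<omega>. (X j \<omega>)\<^sup>2))\<^sup>2)"
  proof (rule char_independent_sum_gaussian_bound[OF X_indep])
    fix j assume "j \<in> I"
    then have j: "j \<ge> 1" by (rule I)
    show "integrable M (X j)" "integrable M (\<lambda>\<omega>. (X j \<omega>)\<^sup>2)" "expectation (X j) = 0"
      using integrable_component[OF j] expectation_square_linear(1)[OF j] centred[OF j]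
      by (simp_all add: X_def[abs_def])
  qed
  also have "\<dots> \<le> (\<Sum>j\<in>I. 8 * ((a j)\<^sup>2 * lindeberg U (K / sqrt n) + (b j)\<^sup>2 * lindeberg V (K / sqrt m))
      + 2 * K\<^sup>2 * (1 / n + 1 / m) * (2 * (a j)\<^sup>2 + 2 * (b j)\<^sup>2))"
    by (intro sum_mono add_mono cap sq)
  also have "\<dots> = 8 * (s\<^sup>2 * lindeberg U (K / sqrt n) + t\<^sup>2 * lindeberg V (K / sqrt m))
      + 2 * K\<^sup>2 * (1 / n + 1 / m) * (2 * s\<^sup>2 + 2 * t\<^sup>2)"
    by (simp only: sum.distrib sum_distrib_left[symmetric] sum_distrib_right[symmetric] sum_a sum_b)
  also have "\<dots> \<le> 8 * (K\<^sup>2 * lindeberg U (K / sqrt n) + K\<^sup>2 * lindeberg V (K / sqrt m))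
      + 2 * K\<^sup>2 * (1 / n + 1 / m) * (2 * K\<^sup>2 + 2 * K\<^sup>2)"
    using lin by (intro add_mono mult_left_mono mult_right_mono st) auto
  also have "\<dots> = 8 * K\<^sup>2 * (lindeberg U (K / sqrt n) + lindeberg V (K / sqrt m)) + 8 * K ^ 4 * (1 / n + 1 / m)"
    by (simp add: algebra_simps power2_eq_square power4_eq_xxxx)
  finally show ?thesis
    unfolding sum_X sum_v .
qed

text \<open>
  The coefficients \<open>s\<close> and \<open>t\<close> are functions of \<open>(n, m)\<close> because the weights of the two means in
  the standardized difference are.
\<close>

lemma joint_characteristic_function_asymptotics:
  fixes s t :: "nat \<times> nat \<Rightarrow> real"
  assumes s: "\<And>p. \<bar>s p\<bar> \<le> K" and t: "\<And>p. \<bar>t p\<bar> \<le> K"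
  shows "((\<lambda>(n, m). (CLINT \<omega>|M. iexp (s (n, m) * normalized_sum U n \<omega> + t (n, m) * normalized_sum V m \<omega>))
      - exp (- ((s (n, m))\<^sup>2 + (t (n, m))\<^sup>2 + 2 * s (n, m) * t (n, m) * sum_correlation n m) / 2)) \<longlongrightarrow> 0)
    double_seq"
proof -
  have "K \<ge> 0" using s[of undefined] by linarith
  have inv_sqrt: "(\<lambda>n. K / sqrt (real n)) \<longlonglongrightarrow> 0"
    by (intro tendsto_divide_0[OF tendsto_const] filterlim_at_top_imp_at_infinity
        filterlim_compose[OF sqrt_at_top filterlim_real_sequentially])
  have fst: "((\<lambda>p. f (fst p)) \<longlongrightarrow> 0) double_seq"
    and snd: "((\<lambda>p. f (snd p)) \<longlongrightarrow> 0) double_seq" if "f \<longlonglongrightarrow> 0" for f :: "nat \<Rightarrow> real"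
    using filterlim_compose[OF that filterlim_fst] filterlim_compose[OF that filterlim_snd] .
  have lin: "(\<lambda>n. lindeberg U (K / sqrt n)) \<longlonglongrightarrow> 0" "(\<lambda>n. lindeberg V (K / sqrt n)) \<longlonglongrightarrow> 0"
    using \<open>K \<ge> 0\<close> measurable_pair_components[of 1] square_integrable[of 1]
    by (auto intro!: lindeberg_tendsto_0 inv_sqrt)
  have bound: "((\<lambda>p. 8 * K\<^sup>2 * (lindeberg U (K / sqrt (fst p)) + lindeberg V (K / sqrt (snd p)))
      + 8 * K ^ 4 * (1 / fst p + 1 / snd p)) \<longlongrightarrow> 8 * K\<^sup>2 * (0 + 0) + 8 * K ^ 4 * (0 + 0)) double_seq"
    by (intro tendsto_intros fst[OF lin(1)] snd[OF lin(2)] fst[OF lim_1_over_n] snd[OF lim_1_over_n])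
  have "\<forall>\<^sub>F p in double_seq. fst p \<ge> 1 \<and> snd p \<ge> (1::nat)"
    by (intro eventually_conj eventually_compose_filterlim[OF eventually_ge_at_top[of 1] filterlim_fst]
          eventually_compose_filterlim[OF eventually_ge_at_top[of 1] filterlim_snd])
  then have "\<forall>\<^sub>F p in double_seq.
      norm (case p of (n, m) \<Rightarrow> (CLINT \<omega>|M. iexp (s (n, m) * normalized_sum U n \<omega> + t (n, m) * normalized_sum V m \<omega>))
        - exp (- ((s (n, m))\<^sup>2 + (t (n, m))\<^sup>2 + 2 * s (n, m) * t (n, m) * sum_correlation n m) / 2))
      \<le> 8 * K\<^sup>2 * (lindeberg U (K / sqrt (fst p)) + lindeberg V (K / sqrt (snd p)))
        + 8 * K ^ 4 * (1 / fst p + 1 / snd p)"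
  proof eventually_elim
    case (elim p)
    then show ?case
      using joint_characteristic_function_bound[OF _ _ s t, of "fst p" "snd p" p p]
      by (cases p) (simp only: prod.case fst_conv snd_conv)
  qed
  then show ?thesis
    by (rule Lim_null_comparison) (use bound in simp)
qed

end

section \<open>Limits along double sequences\<close>

text \<open>
  The continuity theorems speak of sequences of measures. The filter of double sequences has a countable
  basis, so limits along it can be tested on sequences.
\<close>

lemma tendsto_double_seq_if_sequences:
  fixes f :: "nat \<times> nat \<Rightarrow> 'b::topological_space"
  assumes "\<And>p. filterlim p double_seq sequentially \<Longrightarrow> (\<lambda>k. f (p k)) \<longlonglongrightarrow> l"
  shows "(f \<longlongrightarrow> l) double_seq"
proof (rule topological_tendstoI, rule ccontr)
  fix S assume S: "open S" "l \<in> S" and not: "\<not> (\<forall>\<^sub>F x in double_seq. f x \<in> S)"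
  have "\<exists>x. fst x \<ge> k \<and> snd x \<ge> k \<and> f x \<notin> S" for k
  proof (rule ccontr)
    assume "\<not> (\<exists>x. fst x \<ge> k \<and> snd x \<ge> k \<and> f x \<notin> S)"
    then have "f x \<in> S" if "fst x \<ge> k \<and> snd x \<ge> k" for x
      using that by blast
    moreover have "\<forall>\<^sub>F x in double_seq. fst x \<ge> k \<and> snd x \<ge> k"
      by (intro eventually_conj eventually_compose_filterlim[OF eventually_ge_at_top[of k] filterlim_fst]
          eventually_compose_filterlim[OF eventually_ge_at_top[of k] filterlim_snd])
    ultimately have "\<forall>\<^sub>F x in double_seq. f x \<in> S"
      by (rule eventually_mono[rotated])
    with not show False ..
  qed
  then obtain p where p: "\<And>k. fst (p k) \<ge> k \<and> snd (p k) \<ge> k \<and> f (p k) \<notin> S" by metis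
  have "filterlim (\<lambda>k. (fst (p k), snd (p k))) double_seq sequentially"
    using p by (intro filterlim_Pair filterlim_at_top_mono[OF filterlim_ident]) auto
  from topological_tendstoD[OF assms[OF this[simplified]] S]
  show False using p by simp
qed

lemma filterlim_diagonal: "filterlim (\<lambda>k. (k, k)) double_seq sequentially"
  by (intro filterlim_Pair filterlim_ident)

section \<open>Limit theorems for the normalized sums and their converses\<close>

lemma integral_cos_std_normal: "(LINT x|std_normal_distribution. cos (t * x)) = exp (- t\<^sup>2 / 2)"
  and integral_sin_std_normal: "(LINT x|std_normal_distribution. sin (t * x)) = 0"
proof -
  interpret real_distribution std_normal_distribution by (rule real_dist_normal_dist)
  have int: "integrable std_normal_distribution (\<lambda>x. iexp (t * x))"
    by (intro integrable_const_bound[where B=1]) auto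
  have "Re (char std_normal_distribution t) = (LINT x|std_normal_distribution. cos (t * x))"
    "Im (char std_normal_distribution t) = (LINT x|std_normal_distribution. sin (t * x))"
    unfolding char_def using int by (subst integral_Re[symmetric] integral_Im[symmetric]; simp add: Re_exp Im_exp)+
  then show "(LINT x|std_normal_distribution. cos (t * x)) = exp (- t\<^sup>2 / 2)"
    "(LINT x|std_normal_distribution. sin (t * x)) = 0"
    by (simp_all add: char_std_normal_distribution)
qed

text \<open>
  The cosine of \<open>x + y\<close> is the test function that detects a correlation of the two coordinates; this is its
  expectation under the limit law.
\<close>

lemma integral_cos_sum_std_normal_pair:
  "(LINT z|(std_normal_distribution \<Otimes>\<^sub>M std_normal_distribution). cos (fst z + snd z)) = exp (- 1)"
proof -
  interpret N: real_distribution std_normal_distribution by (rule real_dist_normal_dist)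
  interpret pair_prob_space std_normal_distribution std_normal_distribution ..
  have int: "integrable (std_normal_distribution \<Otimes>\<^sub>M std_normal_distribution) (\<lambda>z. f (fst z) * g (snd z))"
    if [measurable]: "f \<in> borel_measurable borel" "g \<in> borel_measurable borel"
      and "\<And>x. \<bar>f x\<bar> \<le> 1" "\<And>x. \<bar>g x\<bar> \<le> 1" for f g :: "real \<Rightarrow> real"
    using that(3,4) by (intro P.integrable_const_bound[where B=1]) (auto simp: abs_mult intro!: mult_le_one)
  note cc = int[of cos cos] and ss = int[of sin sin]
  have "(LINT z|(std_normal_distribution \<Otimes>\<^sub>M std_normal_distribution). cos (fst z + snd z))
    = (LINT x|std_normal_distribution. cos x) * (LINT x|std_normal_distribution. cos x)
      - (LINT x|std_normal_distribution. sin x) * (LINT x|std_normal_distribution. sin x)"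
    using integral_fst_times_snd[OF cc] integral_fst_times_snd[OF ss] cc ss
    by (simp add: cos_add)
  also have "\<dots> = exp (- 1)"
    using integral_cos_std_normal[of 1] integral_sin_std_normal[of 1] by (simp flip: exp_add)
  finally show ?thesis .
qed

context independent_standardized_pairs
begin

abbreviation "Y1 \<equiv> normalized_sum U"
abbreviation "Y2 \<equiv> normalized_sum V"

lemma measurable_normalized_sums [measurable]: "Y1 n \<in> borel_measurable M" "Y2 n \<in> borel_measurable M"
  unfolding normalized_sum_def using measurable_pair_components
  by (auto intro!: borel_measurable_divide borel_measurable_sum)

lemma sum_correlation_le_diagonal: "\<bar>sum_correlation n m\<bar> \<le> \<bar>sum_correlation (min n m) (min n m)\<bar>"
proof (cases "n = 0 \<or> m = 0")
  case False
  define k where "k = min n m"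
  have k: "0 < k" using False by (simp add: k_def)
  have "real k * real k \<le> real n * real m"
    by (intro mult_mono) (auto simp: k_def)
  then have "sqrt (real k * real k) \<le> sqrt (real n * real m)"
    by (rule real_sqrt_le_mono)
  then show ?thesis
    using k unfolding sum_correlation_def k_def[symmetric] abs_divide
    by (intro frac_le) (auto simp: k_def)
qed (auto simp: sum_correlation_def)

text \<open>
  On the diagonal the two quantities coincide; off the diagonal \<open>sqrt (n * m) \<ge> min n m\<close>, so enlarging the
  longer sample only shrinks the average.
\<close>

lemma sum_correlation_tendsto_0_iff:
  "((\<lambda>(n, m). sum_correlation n m) \<longlongrightarrow> 0) double_seq \<longleftrightarrow> (\<lambda>k. sum_correlation k k) \<longlonglongrightarrow> 0"
proof
  assume "((\<lambda>(n, m). sum_correlation n m) \<longlongrightarrow> 0) double_seq"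
  from filterlim_compose[OF this filterlim_diagonal] show "(\<lambda>k. sum_correlation k k) \<longlonglongrightarrow> 0" by simp
next
  assume diag: "(\<lambda>k. sum_correlation k k) \<longlonglongrightarrow> 0"
  have "filterlim (\<lambda>p. min (fst p) (snd p)) sequentially double_seq"
    unfolding filterlim_at_top
    by (auto intro!: eventually_conj eventually_compose_filterlim[OF eventually_ge_at_top filterlim_fst]
          eventually_compose_filterlim[OF eventually_ge_at_top filterlim_snd])
  from filterlim_compose[OF tendsto_rabs_zero[OF diag] this]
  have "((\<lambda>p. \<bar>sum_correlation (min (fst p) (snd p)) (min (fst p) (snd p))\<bar>) \<longlongrightarrow> 0) double_seq" .
  then show "((\<lambda>(n, m). sum_correlation n m) \<longlongrightarrow> 0) double_seq"
    by (rule Lim_null_comparison[rotated]) (simp add: case_prod_beta sum_correlation_le_diagonal)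
qed

text \<open>
  For bounded coefficients the correlation term of the exponent vanishes in the limit, and only the sum of
  squares \<open>v\<close> remains: \<open>s\<^sup>2 + t\<^sup>2\<close> for constant coefficients, \<open>x\<^sup>2\<close> for \<open>x\<close> times a pair of weights on the
  unit circle.
\<close>

lemma characteristic_function_tendsto_gaussian:
  assumes corr: "((\<lambda>(n, m). sum_correlation n m) \<longlongrightarrow> 0) double_seq"
    and s: "\<And>p. \<bar>s p\<bar> \<le> K" and t: "\<And>p. \<bar>t p\<bar> \<le> K"
    and norm: "\<forall>\<^sub>F p in double_seq. (s p)\<^sup>2 + (t p)\<^sup>2 = v"
  shows "((\<lambda>p. CLINT \<omega>|M. iexp (s p * Y1 (fst p) \<omega> + t p * Y2 (snd p) \<omega>)) \<longlongrightarrow> exp (- v / 2)) double_seq"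
proof -
  let ?\<rho> = "\<lambda>p. sum_correlation (fst p) (snd p)"
  have "((\<lambda>p. 2 * (s p * t p) * ?\<rho> p) \<longlongrightarrow> 0) double_seq"
  proof (rule Lim_null_comparison)
    show "((\<lambda>p. 2 * (K * K) * \<bar>?\<rho> p\<bar>) \<longlongrightarrow> 0) double_seq"
      using corr by (intro tendsto_mult_right_zero tendsto_rabs_zero) (simp add: case_prod_beta')
    have "\<bar>s p * t p\<bar> \<le> K * K" for p
      unfolding abs_mult using s[of p] t[of p] by (intro mult_mono) auto
    then have "norm (2 * (s p * t p) * ?\<rho> p) \<le> 2 * (K * K) * \<bar>?\<rho> p\<bar>" for p
      unfolding real_norm_def abs_mult[of _ "?\<rho> p"] abs_mult[of 2] by (intro mult_right_mono) auto
    then show "\<forall>\<^sub>F p in double_seq. norm (2 * (s p * t p) * ?\<rho> p) \<le> 2 * (K * K) * \<bar>?\<rho> p\<bar>"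
      by simp
  qed
  then have "((\<lambda>p. complex_of_real (exp (- (v + 2 * (s p * t p) * ?\<rho> p) / 2))) \<longlongrightarrow> exp (- (v + 0) / 2)) double_seq"
    by (intro tendsto_intros) simp_all
  moreover have "\<forall>\<^sub>F p in double_seq. complex_of_real (exp (- (v + 2 * (s p * t p) * ?\<rho> p) / 2))
      = exp (- ((s p)\<^sup>2 + (t p)\<^sup>2 + 2 * s p * t p * ?\<rho> p) / 2)"
    using norm by eventually_elim (simp add: mult.assoc)
  ultimately have "((\<lambda>p. complex_of_real (exp (- ((s p)\<^sup>2 + (t p)\<^sup>2 + 2 * s p * t p * ?\<rho> p) / 2))) \<longlongrightarrow> exp (- (v + 0) / 2)) double_seq"
    by (rule Lim_transform_eventually)
  from tendsto_add[OF joint_characteristic_function_asymptotics[of s K t, OF s t] this]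
  show ?thesis by (simp add: case_prod_beta')
qed

text \<open>
  The converse direction: the expectation of the cosine always follows
  \<open>exp (- (s\<^sup>2 + t\<^sup>2 + 2 s t \<rho>) / 2)\<close>, and as \<open>s t \<noteq> 0\<close> the correlation \<open>\<rho>\<close> can be recovered by taking
  the logarithm. The cosine being bounded, its expectation can be read off from weak convergence.
\<close>

lemma sum_correlation_tendsto_0_if_cos_expectation:
  assumes st: "s * t \<noteq> 0"
    and lim: "(\<lambda>k. expectation (\<lambda>\<omega>. cos (s * Y1 k \<omega> + t * Y2 k \<omega>))) \<longlonglongrightarrow> exp (- (s\<^sup>2 + t\<^sup>2) / 2)"
  shows "(\<lambda>k. sum_correlation k k) \<longlonglongrightarrow> 0"
proof -
  let ?g = "\<lambda>k. exp (- (s\<^sup>2 + t\<^sup>2 + 2 * s * t * sum_correlation k k) / 2)"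
  have re: "Re (CLINT \<omega>|M. iexp (s * Y1 k \<omega> + t * Y2 k \<omega>)) = expectation (\<lambda>\<omega>. cos (s * Y1 k \<omega> + t * Y2 k \<omega>))" for k
  proof -
    have "integrable M (\<lambda>\<omega>. iexp (s * Y1 k \<omega> + t * Y2 k \<omega>))"
      by (intro integrable_const_bound[where B=1]) auto
    then show ?thesis
      by (subst integral_Re[symmetric]) (auto simp: Re_exp)
  qed
  have "(\<lambda>k. (CLINT \<omega>|M. iexp (s * Y1 k \<omega> + t * Y2 k \<omega>)) - ?g k) \<longlonglongrightarrow> 0"
    using filterlim_compose[OF joint_characteristic_function_asymptotics[of "\<lambda>_. s" "max \<bar>s\<bar> \<bar>t\<bar>" "\<lambda>_. t"] filterlim_diagonal]
    by simp
  from tendsto_Re[OF this]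
  have "(\<lambda>k. expectation (\<lambda>\<omega>. cos (s * Y1 k \<omega> + t * Y2 k \<omega>)) - ?g k) \<longlonglongrightarrow> 0"
    by (simp only: minus_complex.sel re Re_complex_of_real zero_complex.sel)
  from tendsto_diff[OF lim this] have "?g \<longlonglongrightarrow> exp (- (s\<^sup>2 + t\<^sup>2) / 2)"
    by simp
  from tendsto_ln[OF this] have "(\<lambda>k. - (s\<^sup>2 + t\<^sup>2 + 2 * s * t * sum_correlation k k) / 2) \<longlonglongrightarrow> - (s\<^sup>2 + t\<^sup>2) / 2"
    by (simp only: ln_exp exp_not_eq_zero not_False_eq_True simp_thms)
  from tendsto_mult[OF tendsto_const[of "- 1 / (s * t)"] tendsto_diff[OF this tendsto_const[of "- (s\<^sup>2 + t\<^sup>2) / 2"]]]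
  have "(\<lambda>k. (- 1 / (s * t)) * (- (s\<^sup>2 + t\<^sup>2 + 2 * s * t * sum_correlation k k) / 2 - - (s\<^sup>2 + t\<^sup>2) / 2)) \<longlonglongrightarrow> 0"
    by simp
  moreover have "(- 1 / (s * t)) * (- (s\<^sup>2 + t\<^sup>2 + 2 * s * t * r) / 2 - - (s\<^sup>2 + t\<^sup>2) / 2) = r" for r
    using st by (simp add: field_simps)
  ultimately show ?thesis by (simp only:)
qed

lemma joint_clt:
  assumes corr: "((\<lambda>(n, m). sum_correlation n m) \<longlongrightarrow> 0) double_seq"
    and F: "continuous_on UNIV F" "bounded (range F)"
  shows "((\<lambda>p. expectation (\<lambda>\<omega>. F (Y1 (fst p) \<omega>, Y2 (snd p) \<omega>) :: real))
    \<longlongrightarrow> integral\<^sup>L (std_normal_distribution \<Otimes>\<^sub>M std_normal_distribution) F) double_seq"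
proof (rule tendsto_double_seq_if_sequences)
  fix p :: "nat \<Rightarrow> nat \<times> nat" assume p: "filterlim p double_seq sequentially"
  have rv: "(\<lambda>\<omega>. (Y1 n \<omega>, Y2 m \<omega>)) \<in> measurable M borel" for n m
    unfolding borel_prod[symmetric] by measurable
  define P where "P k = distr M borel (\<lambda>\<omega>. (Y1 (fst (p k)) \<omega>, Y2 (snd (p k)) \<omega>))" for k
  have "(\<lambda>k. integral\<^sup>L (P k) F) \<longlonglongrightarrow> integral\<^sup>L (std_normal_distribution \<Otimes>\<^sub>M std_normal_distribution) F"
  proof (rule levy_continuity_plane[OF _ _ real_dist_normal_dist real_dist_normal_dist _ F])
    show "prob_space (P k)" for k
      unfolding P_def by (rule prob_space_distr[OF rv])
    show "sets (P k) = sets borel" for k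
      by (simp add: P_def)
    fix s t :: real
    have "((\<lambda>p. CLINT \<omega>|M. iexp (s * Y1 (fst p) \<omega> + t * Y2 (snd p) \<omega>)) \<longlongrightarrow> exp (- (s\<^sup>2 + t\<^sup>2) / 2)) double_seq"
      using characteristic_function_tendsto_gaussian[OF corr, of "\<lambda>_. s" "max \<bar>s\<bar> \<bar>t\<bar>" "\<lambda>_. t" "s\<^sup>2 + t\<^sup>2"] by simp
    from filterlim_compose[OF this p]
    have "(\<lambda>k. CLINT \<omega>|M. iexp (s * Y1 (fst (p k)) \<omega> + t * Y2 (snd (p k)) \<omega>)) \<longlonglongrightarrow> exp (- (s\<^sup>2 + t\<^sup>2) / 2)" .
    moreover have "complex_of_real (exp (- (s\<^sup>2 + t\<^sup>2) / 2)) = char std_normal_distribution s * char std_normal_distribution t"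
      unfolding char_std_normal_distribution of_real_mult[symmetric] exp_add[symmetric] by (simp add: field_simps)
    moreover have "(CLINT z|P k. iexp (s * fst z + t * snd z)) = (CLINT \<omega>|M. iexp (s * Y1 (fst (p k)) \<omega> + t * Y2 (snd (p k)) \<omega>))" for k
      unfolding P_def by (subst integral_distr[OF rv]) (auto intro!: borel_measurable_continuous_onI continuous_intros)
    ultimately show "(\<lambda>k. CLINT z|P k. iexp (s * fst z + t * snd z)) \<longlonglongrightarrow> char std_normal_distribution s * char std_normal_distribution t"
      by simp
  qed
  moreover have "integral\<^sup>L (P k) F = expectation (\<lambda>\<omega>. F (Y1 (fst (p k)) \<omega>, Y2 (snd (p k)) \<omega>))" for k
    unfolding P_def by (rule integral_distr[OF rv borel_measurable_continuous_onI[OF F(1)]])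
  ultimately show "(\<lambda>k. expectation (\<lambda>\<omega>. F (Y1 (fst (p k)) \<omega>, Y2 (snd (p k)) \<omega>)))
      \<longlonglongrightarrow> integral\<^sup>L (std_normal_distribution \<Otimes>\<^sub>M std_normal_distribution) F"
    by simp
qed

lemma linear_combination_clt:
  assumes corr: "((\<lambda>(n, m). sum_correlation n m) \<longlongrightarrow> 0) double_seq"
    and \<alpha>: "\<And>p. \<bar>\<alpha> p\<bar> \<le> 1" and \<beta>: "\<And>p. \<bar>\<beta> p\<bar> \<le> 1"
    and unit: "\<forall>\<^sub>F p in double_seq. (\<alpha> p)\<^sup>2 + (\<beta> p)\<^sup>2 = 1"
    and f: "continuous_on UNIV f" "bounded (range f)"
  shows "((\<lambda>p. expectation (\<lambda>\<omega>. f (\<alpha> p * Y1 (fst p) \<omega> + \<beta> p * Y2 (snd p) \<omega>) :: real))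
    \<longlongrightarrow> integral\<^sup>L std_normal_distribution f) double_seq"
proof (rule tendsto_double_seq_if_sequences)
  fix p :: "nat \<Rightarrow> nat \<times> nat" assume p: "filterlim p double_seq sequentially"
  define W where "W k \<omega> = \<alpha> (p k) * Y1 (fst (p k)) \<omega> + \<beta> (p k) * Y2 (snd (p k)) \<omega>" for k \<omega>
  have rv: "W k \<in> borel_measurable M" for k
    unfolding W_def by measurable
  have char_lim: "(\<lambda>k. char (distr M borel (W k)) x) \<longlonglongrightarrow> char std_normal_distribution x" for x
  proof -
    have "\<bar>x * \<alpha> q\<bar> \<le> \<bar>x\<bar>" "\<bar>x * \<beta> q\<bar> \<le> \<bar>x\<bar>" for q
      using \<alpha>[of q] \<beta>[of q] by (auto simp: abs_mult intro: mult_left_le)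
    moreover have "\<forall>\<^sub>F q in double_seq. (x * \<alpha> q)\<^sup>2 + (x * \<beta> q)\<^sup>2 = x\<^sup>2"
      using unit by eventually_elim (simp add: power_mult_distrib flip: distrib_left)
    ultimately have "((\<lambda>q. CLINT \<omega>|M. iexp (x * \<alpha> q * Y1 (fst q) \<omega> + x * \<beta> q * Y2 (snd q) \<omega>)) \<longlongrightarrow> exp (- x\<^sup>2 / 2)) double_seq"
      by (rule characteristic_function_tendsto_gaussian[OF corr])
    from filterlim_compose[OF this p] show ?thesis
      using rv by (simp add: char_def[of "distr M borel _"] integral_distr char_std_normal_distribution W_def ring_distribs mult.assoc)
  qed
  obtain B where B: "\<And>x. norm (f x) \<le> B"
    using f(2) unfolding bounded_iff by auto
  have "weak_conv_m (\<lambda>k. distr M borel (W k)) std_normal_distribution"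
    using rv char_lim by (intro levy_continuity real_dist_normal_dist) auto
  then have "(\<lambda>k. integral\<^sup>L (distr M borel (W k)) f) \<longlonglongrightarrow> integral\<^sup>L std_normal_distribution f"
    using f(1) B rv
    by (intro weak_conv_imp_integral_bdd_continuous_conv real_dist_normal_dist)
       (auto simp: continuous_on_eq_continuous_at)
  then show "(\<lambda>k. expectation (\<lambda>\<omega>. f (\<alpha> (p k) * Y1 (fst (p k)) \<omega> + \<beta> (p k) * Y2 (snd (p k)) \<omega>)))
      \<longlonglongrightarrow> integral\<^sup>L std_normal_distribution f"
    using integral_distr[OF rv borel_measurable_continuous_onI[OF f(1)]] by (simp add: W_def)
qed

end

section \<open>Equivalence of the four statements\<close>

lemma (in prob_space) standardized_moments:
  fixes X :: "'a \<Rightarrow> real"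
  assumes X: "integrable M X" "integrable M (\<lambda>\<omega>. (X \<omega>)\<^sup>2)" "expectation X = \<mu>" "variance X = \<sigma>\<^sup>2" "\<sigma> > 0"
  shows "integrable M (\<lambda>\<omega>. ((X \<omega> - \<mu>) / \<sigma>)\<^sup>2)"
    and "expectation (\<lambda>\<omega>. (X \<omega> - \<mu>) / \<sigma>) = 0"
    and "expectation (\<lambda>\<omega>. ((X \<omega> - \<mu>) / \<sigma>)\<^sup>2) = 1"
proof -
  have "(\<lambda>\<omega>. ((X \<omega> - \<mu>) / \<sigma>)\<^sup>2) = (\<lambda>\<omega>. ((X \<omega>)\<^sup>2 - 2 * \<mu> * X \<omega> + \<mu>\<^sup>2) / \<sigma>\<^sup>2)"
    by (auto simp: power_divide power2_eq_square algebra_simps)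
  then show "integrable M (\<lambda>\<omega>. ((X \<omega> - \<mu>) / \<sigma>)\<^sup>2)"
    using X by simp
  show "expectation (\<lambda>\<omega>. (X \<omega> - \<mu>) / \<sigma>) = 0"
    using X by (simp add: prob_space)
  show "expectation (\<lambda>\<omega>. ((X \<omega> - \<mu>) / \<sigma>)\<^sup>2) = 1"
    using X by (simp add: power_divide)
qed

theorem theorem1:
  fixes M :: "'a measure"
    and X1 X2 :: "nat \<Rightarrow> 'a \<Rightarrow> real"
    and \<mu>1 \<mu>2 \<sigma>1 \<sigma>2 :: real
  assumes "prob_space M"
    and "prob_space.iid_seq M X1"
    and "prob_space.iid_seq M X2"
    and "\<And>j. j \<ge> 1 \<Longrightarrow> integrable M (X1 j)"
    and "\<And>j. j \<ge> 1 \<Longrightarrow> integrable M (X2 j)"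
    and "\<And>j. j \<ge> 1 \<Longrightarrow> integrable M (\<lambda>\<omega>. (X1 j \<omega>)\<^sup>2)"
    and "\<And>j. j \<ge> 1 \<Longrightarrow> integrable M (\<lambda>\<omega>. (X2 j \<omega>)\<^sup>2)"
    and "\<And>j. j \<ge> 1 \<Longrightarrow> prob_space.expectation M (X1 j) = \<mu>1"
    and "\<And>j. j \<ge> 1 \<Longrightarrow> prob_space.expectation M (X2 j) = \<mu>2"
    and "\<And>j. j \<ge> 1 \<Longrightarrow> prob_space.variance M (X1 j) = \<sigma>1\<^sup>2"
    and "\<And>j. j \<ge> 1 \<Longrightarrow> prob_space.variance M (X2 j) = \<sigma>2\<^sup>2"
    and "\<sigma>1 > 0"
    and "\<sigma>2 > 0"
    and "prob_space.indep_vars M (\<lambda>_. borel) (\<lambda>j \<omega>. (X1 j \<omega>, X2 j \<omega>)) {1..}"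
  defines "a \<equiv> ((\<lambda>(n1, n2). prob_space.avg_correlation M X1 X2 n1 n2) \<longlongrightarrow> 0) double_seq"
    and "b \<equiv> (\<lambda>k. 1 / real k * (\<Sum>j=1..k. prob_space.correlation M (X1 j) (X2 j))) \<longlonglongrightarrow> 0"
    and "c \<equiv> weak_conv_filter
               (\<lambda>(n1, n2). distr M borel
                  (\<lambda>\<omega>. (standardized_mean X1 \<mu>1 \<sigma>1 n1 \<omega>, standardized_mean X2 \<mu>2 \<sigma>2 n2 \<omega>)))
               (std_normal_distribution \<Otimes>\<^sub>M std_normal_distribution) double_seq"
    and "d \<equiv> weak_conv_filter
               (\<lambda>(n1, n2). distr M borel (standardized_mean_diff X1 X2 \<mu>1 \<mu>2 \<sigma>1 \<sigma>2 n1 n2))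
               std_normal_distribution double_seq"
  shows "(a \<longleftrightarrow> b) \<and> (b \<longleftrightarrow> c) \<and> (c \<longleftrightarrow> d)"
proof -
  interpret prob_space M by fact
  define U where "U j \<omega> = (X1 j \<omega> - \<mu>1) / \<sigma>1" for j \<omega>
  define V where "V j \<omega> = (X2 j \<omega> - \<mu>2) / \<sigma>2" for j \<omega>
  have X_rv: "X1 j \<in> borel_measurable M" "X2 j \<in> borel_measurable M" if "j \<ge> 1" for j
    using assms(4,5)[OF that] by auto
  have standardized_distr: "distr M borel (\<lambda>\<omega>. (X j \<omega> - \<mu>) / \<sigma>) = distr M borel (\<lambda>\<omega>. (X 1 \<omega> - \<mu>) / \<sigma>)"
    if "iid_seq X" "j \<ge> 1" "\<And>j. j \<ge> 1 \<Longrightarrow> X j \<in> borel_measurable M" for X :: "nat \<Rightarrow> 'a \<Rightarrow> real" and j \<mu> \<sigma>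
  proof -
    have "distr M borel (\<lambda>\<omega>. (X i \<omega> - \<mu>) / \<sigma>) = distr (distr M borel (X i)) borel (\<lambda>x. (x - \<mu>) / \<sigma>)" if "i \<ge> 1" for i
      using \<open>\<And>j. j \<ge> 1 \<Longrightarrow> X j \<in> borel_measurable M\<close>[OF that] by (subst distr_distr) (auto simp: comp_def)
    moreover have "distr M borel (X j) = distr M borel (X 1)"
      using that(1,2) unfolding iid_seq_def by blast
    ultimately show ?thesis
      using \<open>j \<ge> 1\<close> by simp
  qed
  interpret P: independent_standardized_pairs M U V
  proof
    have "indep_vars (\<lambda>_. borel) (\<lambda>j \<omega>. (\<lambda>z. ((fst z - \<mu>1) / \<sigma>1, (snd z - \<mu>2) / \<sigma>2)) (X1 j \<omega>, X2 j \<omega>)) {1..}"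
    proof (rule indep_vars_compose2[where Y="\<lambda>_ z. ((fst z - \<mu>1) / \<sigma>1, (snd z - \<mu>2) / \<sigma>2)", OF assms(14)])
      show "(\<lambda>z. ((fst z - \<mu>1) / \<sigma>1, (snd z - \<mu>2) / \<sigma>2)) \<in> measurable borel borel"
        using assms(12,13) by (intro borel_measurable_continuous_onI continuous_intros) auto
    qed
    then show "indep_vars (\<lambda>_. borel) (\<lambda>j \<omega>. (U j \<omega>, V j \<omega>)) {1..}"
      by (simp add: U_def[abs_def] V_def[abs_def])
    fix j :: nat assume j: "j \<ge> 1"
    show "distr M borel (U j) = distr M borel (U 1)" "distr M borel (V j) = distr M borel (V 1)"
      using standardized_distr[OF assms(2) j X_rv(1)] standardized_distr[OF assms(3) j X_rv(2)]
      by (simp_all add: U_def[abs_def] V_def[abs_def])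
    show "integrable M (\<lambda>\<omega>. (U j \<omega>)\<^sup>2)" "expectation (U j) = 0" "expectation (\<lambda>\<omega>. (U j \<omega>)\<^sup>2) = 1"
      unfolding U_def[abs_def] using assms(12)
      by (intro standardized_moments assms(4,6,8,10) j; assumption)+
    show "integrable M (\<lambda>\<omega>. (V j \<omega>)\<^sup>2)" "expectation (V j) = 0" "expectation (\<lambda>\<omega>. (V j \<omega>)\<^sup>2) = 1"
      unfolding V_def[abs_def] using assms(13)
      by (intro standardized_moments assms(5,7,9,11) j; assumption)+
  qed
  have correlation: "correlation (X1 j) (X2 j) = expectation (\<lambda>\<omega>. U j \<omega> * V j \<omega>)" if "j \<ge> 1" for j
    unfolding correlation_def covariance_def assms(10,11)[OF that] unfolding assms(8,9)[OF that] U_def V_def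
    using assms(12,13) by simp
  have avg_correlation: "avg_correlation X1 X2 n m = P.sum_correlation n m" for n m
    unfolding avg_correlation_def P.sum_correlation_def by (simp add: correlation)
  have cesaro: "1 / real k * (\<Sum>j=1..k. correlation (X1 j) (X2 j)) = P.sum_correlation k k" for k
    unfolding P.sum_correlation_def by (simp add: correlation)
  have a: "a \<longleftrightarrow> ((\<lambda>(n, m). P.sum_correlation n m) \<longlongrightarrow> 0) double_seq"
    unfolding a_def by (simp add: avg_correlation)
  have b: "b \<longleftrightarrow> (\<lambda>k. P.sum_correlation k k) \<longlonglongrightarrow> 0"
    unfolding b_def by (simp only: cesaro)
  have ab: "a \<longleftrightarrow> b"
    unfolding a b by (rule P.sum_correlation_tendsto_0_iff)
  have standardized: "standardized_mean X1 \<mu>1 \<sigma>1 n = P.Y1 n" "standardized_mean X2 \<mu>2 \<sigma>2 n = P.Y2 n" for n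
  proof -
    have "sqrt (real n) * ((\<Sum>j=1..n. X j \<omega>) / real n - \<mu>) / \<sigma> = (\<Sum>j=1..n. (X j \<omega> - \<mu>) / \<sigma>) / sqrt (real n)"
      for X :: "nat \<Rightarrow> 'a \<Rightarrow> real" and \<mu> \<sigma> \<omega>
    proof (cases "n = 0")
      case False
      have "(\<Sum>j=1..n. (X j \<omega> - \<mu>) / \<sigma>) / sqrt (real n) = ((\<Sum>j=1..n. X j \<omega>) - real n * \<mu>) / \<sigma> / sqrt (real n)"
        by (simp add: sum_divide_distrib[symmetric] sum_subtractf)
      also have "\<dots> = sqrt (real n) * ((\<Sum>j=1..n. X j \<omega>) / real n - \<mu>) / \<sigma>"
      proof -
        have "(x - q * q * \<mu>) / \<sigma> / q = q * (x / (q * q) - \<mu>) / \<sigma>" if "q > 0" for x q :: real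
          using that by (cases "\<sigma> = 0") (simp_all add: field_simps)
        from this[of "sqrt (real n)"] show ?thesis
          using False by simp
      qed
      finally show ?thesis ..
    qed simp
    then show "standardized_mean X1 \<mu>1 \<sigma>1 n = P.Y1 n" "standardized_mean X2 \<mu>2 \<sigma>2 n = P.Y2 n"
      by (simp_all add: fun_eq_iff standardized_mean_def sample_mean_def P.normalized_sum_def U_def V_def)
  qed
  have pair_integral: "integral\<^sup>L (case p of (n1, n2) \<Rightarrow> distr M borel
        (\<lambda>\<omega>. (standardized_mean X1 \<mu>1 \<sigma>1 n1 \<omega>, standardized_mean X2 \<mu>2 \<sigma>2 n2 \<omega>))) F
      = expectation (\<lambda>\<omega>. F (P.Y1 (fst p) \<omega>, P.Y2 (snd p) \<omega>))"
    if "continuous_on UNIV F" for p and F :: "real \<times> real \<Rightarrow> real"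
  proof -
    have "(\<lambda>\<omega>. (P.Y1 (fst p) \<omega>, P.Y2 (snd p) \<omega>)) \<in> measurable M borel"
      unfolding borel_prod[symmetric] by measurable
    from integral_distr[OF this borel_measurable_continuous_onI[OF that]] show ?thesis
      by (simp add: standardized case_prod_beta)
  qed
  \<comment> \<open>The standardized difference is \<open>\<alpha> * Y1 + \<beta> * Y2\<close>; only for positive sizes, because the mean of an empty sample has the default value \<open>0\<close> of a division by \<open>0\<close>.\<close>
  define \<alpha> where "\<alpha> p = (\<sigma>1 / sqrt (fst p)) / sqrt (\<sigma>1\<^sup>2 / fst p + \<sigma>2\<^sup>2 / snd p)" for p :: "nat \<times> nat"
  define \<beta> where "\<beta> p = - (\<sigma>2 / sqrt (snd p)) / sqrt (\<sigma>1\<^sup>2 / fst p + \<sigma>2\<^sup>2 / snd p)" for p :: "nat \<times> nat"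
  have \<alpha>_sq: "(\<alpha> p)\<^sup>2 = (\<sigma>1\<^sup>2 / fst p) / (\<sigma>1\<^sup>2 / fst p + \<sigma>2\<^sup>2 / snd p)"
    and \<beta>_sq: "(\<beta> p)\<^sup>2 = (\<sigma>2\<^sup>2 / snd p) / (\<sigma>1\<^sup>2 / fst p + \<sigma>2\<^sup>2 / snd p)" for p
    by (simp_all add: \<alpha>_def \<beta>_def power_divide power_mult_distrib)
  have weights_le_1: "\<bar>\<alpha> p\<bar> \<le> 1" "\<bar>\<beta> p\<bar> \<le> 1" for p
  proof -
    have "x / (x + y) \<le> 1" "y / (x + y) \<le> 1" if "0 \<le> x" "0 \<le> y" for x y :: real
      using that by (auto simp: divide_le_eq_1)
    then have "(\<alpha> p)\<^sup>2 \<le> 1" "(\<beta> p)\<^sup>2 \<le> 1"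
      unfolding \<alpha>_sq \<beta>_sq by (simp_all only: zero_le_divide_iff zero_le_power2 of_nat_0_le_iff simp_thms)
    then show "\<bar>\<alpha> p\<bar> \<le> 1" "\<bar>\<beta> p\<bar> \<le> 1"
      by (simp_all add: abs_square_le_1)
  qed
  have unit: "(\<alpha> p)\<^sup>2 + (\<beta> p)\<^sup>2 = 1" if "fst p \<ge> 1 \<and> snd p \<ge> 1" for p
  proof -
    have "0 < \<sigma>1\<^sup>2 / fst p + \<sigma>2\<^sup>2 / snd p"
      using that assms(12,13) by (intro add_pos_pos divide_pos_pos) auto
    then show ?thesis
      unfolding \<alpha>_sq \<beta>_sq add_divide_distrib[symmetric] by (intro divide_self) simp
  qed
  have difference: "standardized_mean_diff X1 X2 \<mu>1 \<mu>2 \<sigma>1 \<sigma>2 (fst p) (snd p)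
      = (\<lambda>\<omega>. \<alpha> p * P.Y1 (fst p) \<omega> + \<beta> p * P.Y2 (snd p) \<omega>)" if "fst p \<ge> 1 \<and> snd p \<ge> 1" for p
  proof
    fix \<omega>
    have unscale: "sample_mean X n \<omega> - \<mu> = \<sigma> / sqrt n * standardized_mean X \<mu> \<sigma> n \<omega>"
      if "n \<ge> 1" "\<sigma> > 0" for X :: "nat \<Rightarrow> 'a \<Rightarrow> real" and \<mu> \<sigma> and n :: nat
      using that by (simp add: standardized_mean_def)
    show "standardized_mean_diff X1 X2 \<mu>1 \<mu>2 \<sigma>1 \<sigma>2 (fst p) (snd p) \<omega> = \<alpha> p * P.Y1 (fst p) \<omega> + \<beta> p * P.Y2 (snd p) \<omega>"
      unfolding standardized_mean_diff_def standardized[symmetric]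
      using unscale[of "fst p" \<sigma>1 X1 \<mu>1] unscale[of "snd p" \<sigma>2 X2 \<mu>2] that assms(12,13)
      by (simp add: \<alpha>_def \<beta>_def diff_divide_distrib)
  qed
  have eventually_pos: "\<forall>\<^sub>F p in double_seq. fst p \<ge> 1 \<and> snd p \<ge> (1::nat)"
    by (intro eventually_conj eventually_compose_filterlim[OF eventually_ge_at_top[of 1] filterlim_fst]
          eventually_compose_filterlim[OF eventually_ge_at_top[of 1] filterlim_snd])
  have diff_integral: "integral\<^sup>L (case p of (n1, n2) \<Rightarrow> distr M borel (standardized_mean_diff X1 X2 \<mu>1 \<mu>2 \<sigma>1 \<sigma>2 n1 n2)) f
      = expectation (\<lambda>\<omega>. f (\<alpha> p * P.Y1 (fst p) \<omega> + \<beta> p * P.Y2 (snd p) \<omega>))"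
    if "continuous_on UNIV f" "fst p \<ge> 1 \<and> snd p \<ge> 1" for p and f :: "real \<Rightarrow> real"
  proof -
    have "(\<lambda>\<omega>. \<alpha> p * P.Y1 (fst p) \<omega> + \<beta> p * P.Y2 (snd p) \<omega>) \<in> borel_measurable M"
      by measurable
    from integral_distr[OF this borel_measurable_continuous_onI[OF that(1)]] show ?thesis
      by (simp add: case_prod_beta difference[OF that(2)])
  qed
  have "b \<Longrightarrow> c"
    using P.joint_clt ab unfolding a c_def weak_conv_filter_def by (simp add: pair_integral)
  moreover have "b" if "c"
  proof -
    have F: "continuous_on UNIV (\<lambda>z :: real \<times> real. cos (fst z + snd z))" "bounded (range (\<lambda>z :: real \<times> real. cos (fst z + snd z)))"
      by (auto intro!: continuous_intros boundedI[where B=1])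
    have "((\<lambda>p. expectation (\<lambda>\<omega>. cos (P.Y1 (fst p) \<omega> + P.Y2 (snd p) \<omega>))) \<longlongrightarrow> exp (- 1)) double_seq"
      using that F unfolding c_def weak_conv_filter_def
      by (auto dest!: spec[of _ "\<lambda>z. cos (fst z + snd z)"] simp: pair_integral integral_cos_sum_std_normal_pair)
    from filterlim_compose[OF this filterlim_diagonal]
    show b
      unfolding b using P.sum_correlation_tendsto_0_if_cos_expectation[of 1 1] by simp
  qed
  moreover have "d" if "b"
    unfolding d_def weak_conv_filter_def
  proof (intro allI impI)
    fix f :: "real \<Rightarrow> real" assume f: "continuous_on UNIV f" "bounded (range f)"
    have "((\<lambda>p. expectation (\<lambda>\<omega>. f (\<alpha> p * P.Y1 (fst p) \<omega> + \<beta> p * P.Y2 (snd p) \<omega>)))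
        \<longlongrightarrow> integral\<^sup>L std_normal_distribution f) double_seq"
      using that eventually_mono[OF eventually_pos unit] f
      by (intro P.linear_combination_clt weights_le_1) (auto simp: ab[symmetric] a)
    moreover have "\<forall>\<^sub>F p in double_seq. expectation (\<lambda>\<omega>. f (\<alpha> p * P.Y1 (fst p) \<omega> + \<beta> p * P.Y2 (snd p) \<omega>))
        = integral\<^sup>L (case p of (n1, n2) \<Rightarrow> distr M borel (standardized_mean_diff X1 X2 \<mu>1 \<mu>2 \<sigma>1 \<sigma>2 n1 n2)) f"
      using eventually_pos by eventually_elim (simp only: diff_integral[OF f(1)])
    ultimately show "((\<lambda>p. integral\<^sup>L (case p of (n1, n2) \<Rightarrow> distr M borel (standardized_mean_diff X1 X2 \<mu>1 \<mu>2 \<sigma>1 \<sigma>2 n1 n2)) f)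
        \<longlongrightarrow> integral\<^sup>L std_normal_distribution f) double_seq"
      by (rule Lim_transform_eventually)
  qed
  moreover have "b" if "d"
  proof -
    define r where "r = sqrt (\<sigma>1\<^sup>2 + \<sigma>2\<^sup>2)"
    have r: "0 < r" "r\<^sup>2 = \<sigma>1\<^sup>2 + \<sigma>2\<^sup>2"
      using assms(12,13) by (auto simp: r_def add_pos_pos)
    \<comment> \<open>For equal sample sizes the factor \<open>1 / sqrt k\<close> cancels and the weights become constants.\<close>
    have diagonal: "\<alpha> (k, k) = \<sigma>1 / r" "\<beta> (k, k) = - \<sigma>2 / r" if "k \<ge> 1" for k
      using that by (simp_all add: \<alpha>_def \<beta>_def r_def real_sqrt_divide flip: add_divide_distrib)
    have f: "continuous_on UNIV (cos :: real \<Rightarrow> real)" "bounded (range (cos :: real \<Rightarrow> real))"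
      by (auto intro!: continuous_intros boundedI[where B=1])
    have "((\<lambda>p. integral\<^sup>L (case p of (n1, n2) \<Rightarrow> distr M borel (standardized_mean_diff X1 X2 \<mu>1 \<mu>2 \<sigma>1 \<sigma>2 n1 n2)) cos)
        \<longlongrightarrow> integral\<^sup>L std_normal_distribution cos) double_seq"
      using that f unfolding d_def weak_conv_filter_def by blast
    from filterlim_compose[OF this filterlim_diagonal]
    have "(\<lambda>k. integral\<^sup>L (distr M borel (standardized_mean_diff X1 X2 \<mu>1 \<mu>2 \<sigma>1 \<sigma>2 k k)) cos) \<longlonglongrightarrow> exp (- 1 / 2)"
      using integral_cos_std_normal[of 1] by simp
    moreover have "\<forall>\<^sub>F k in sequentially. integral\<^sup>L (distr M borel (standardized_mean_diff X1 X2 \<mu>1 \<mu>2 \<sigma>1 \<sigma>2 k k)) cos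
        = expectation (\<lambda>\<omega>. cos (\<sigma>1 / r * P.Y1 k \<omega> + (- \<sigma>2 / r) * P.Y2 k \<omega>))"
      using eventually_ge_at_top[of 1]
    proof eventually_elim
      case (elim k)
      then show ?case
        using diff_integral[OF f(1), of "(k, k)"] by (simp add: diagonal)
    qed
    ultimately have "(\<lambda>k. expectation (\<lambda>\<omega>. cos (\<sigma>1 / r * P.Y1 k \<omega> + (- \<sigma>2 / r) * P.Y2 k \<omega>))) \<longlonglongrightarrow> exp (- 1 / 2)"
      by (rule Lim_transform_eventually)
    moreover have "(\<sigma>1 / r)\<^sup>2 + (- \<sigma>2 / r)\<^sup>2 = 1"
      using r assms(12) by (simp add: power_divide flip: add_divide_distrib)
    moreover have "\<sigma>1 / r * (- \<sigma>2 / r) \<noteq> 0"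
      using assms(12,13) r by simp
    ultimately show b
      unfolding b using P.sum_correlation_tendsto_0_if_cos_expectation[of "\<sigma>1 / r" "- \<sigma>2 / r"] by simp
  qed
  ultimately show ?thesis
    using ab by blast
qed

end
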